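(* Let $p$ be a prime with $p\equiv 1 \bmod 16$. Then $\mathrm{SL}(2,p)$ contains a subgroup plus coset core $S$ of size $64$ with $|S^3|=224$.
   Context: For a subset $S$ of a group, $S^3=\{abc: a,b,c\in S\}$. A subgroup plus coset core in $\mathrm{SL}(2,p)$ is a set of the form $S=H\cup(xH\cap Hx)$, where $H$ is a proper subgroup of $\mathrm{SL}(2,p)$ and $x\in\mathrm{SL}(2,p)$ satisfies $\langle H,x\rangle=\mathrm{SL}(2,p)$ and $x^2\in H$. *)

theory Defs
  imports
    "HOL-Analysis.Determinants"
    "HOL-Number_Theory.Cong"
    "HOL-Algebra.Generated_Groups"
begin

text \<open>
  The field with \<open>p\<close> elements is represented by the residues \<open>{0..<p}\<close>, so that \<open>p\<close> is an
  ordinary natural number and not the cardinality of a type; matrices over it are integer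
  matrices with entries in this range.
\<close>

definition reduce_mod :: "nat \<Rightarrow> int ^ 2 ^ 2 \<Rightarrow> int ^ 2 ^ 2"
  where "reduce_mod p A = (\<chi> i j. (A $ i $ j) mod int p)"

definition SL2 :: "nat \<Rightarrow> (int ^ 2 ^ 2) monoid"
  where "SL2 p =
    \<lparr>carrier = {A. (\<forall>i j. A $ i $ j \<in> {0..<int p}) \<and> [det A = 1] (mod int p)},
     mult = (\<lambda>A B. reduce_mod p (A ** B)),
     one = reduce_mod p (mat 1)\<rparr>"

lemma reduce_mod_mult_left: "reduce_mod p (reduce_mod p A ** B) = reduce_mod p (A ** B)"
  unfolding reduce_mod_def matrix_matrix_mult_def vec_eq_iff
  by (simp add: sum_2 flip: cong_def) (intro allI cong_add cong_mult; simp add: cong_def)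

lemma reduce_mod_mult_right: "reduce_mod p (A ** reduce_mod p B) = reduce_mod p (A ** B)"
  unfolding reduce_mod_def matrix_matrix_mult_def vec_eq_iff
  by (simp add: sum_2 flip: cong_def) (intro allI cong_add cong_mult; simp add: cong_def)

lemma cong_det_reduce_mod: "[det (reduce_mod p A) = det A] (mod int p)"
  unfolding reduce_mod_def det_2
  by (simp, intro cong_diff cong_mult) (simp_all add: cong_def)

lemma reduce_mod_in_SL2:
  assumes "p > 0" and "[det A = 1] (mod int p)"
  shows "reduce_mod p A \<in> carrier (SL2 p)"
  using assms cong_trans[OF cong_det_reduce_mod]
  by (auto simp: SL2_def reduce_mod_def)

lemma reduce_mod_SL2: "A \<in> carrier (SL2 p) \<Longrightarrow> reduce_mod p A = A"
  by (simp add: SL2_def reduce_mod_def vec_eq_iff)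

lemma group_SL2:
  assumes "p > 0"
  shows "group (SL2 p)"
proof (rule groupI)
  show "\<one>\<^bsub>SL2 p\<^esub> \<in> carrier (SL2 p)"
    using reduce_mod_in_SL2[OF assms, of "mat 1"] by (simp add: SL2_def)
next
  fix A B
  assume A: "A \<in> carrier (SL2 p)" and B: "B \<in> carrier (SL2 p)"
  have "[det A * det B = 1 * 1] (mod int p)"
    using A B by (intro cong_mult) (auto simp: SL2_def)
  then have "reduce_mod p (A ** B) \<in> carrier (SL2 p)"
    by (intro reduce_mod_in_SL2 assms) (simp add: det_mul)
  then show "A \<otimes>\<^bsub>SL2 p\<^esub> B \<in> carrier (SL2 p)"
    by (simp add: SL2_def)
next
  fix A B C
  show "A \<otimes>\<^bsub>SL2 p\<^esub> B \<otimes>\<^bsub>SL2 p\<^esub> C = A \<otimes>\<^bsub>SL2 p\<^esub> (B \<otimes>\<^bsub>SL2 p\<^esub> C)"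
    by (simp add: SL2_def reduce_mod_mult_left reduce_mod_mult_right matrix_mul_assoc)
next
  fix A
  assume A: "A \<in> carrier (SL2 p)"
  then show "\<one>\<^bsub>SL2 p\<^esub> \<otimes>\<^bsub>SL2 p\<^esub> A = A"
    using reduce_mod_SL2[OF A] by (simp add: SL2_def reduce_mod_mult_left)
  define B :: "int ^ 2 ^ 2"
    where "B = vector [vector [A $ 2 $ 2, - A $ 1 $ 2], vector [- A $ 2 $ 1, A $ 1 $ 1]]"
  have d: "[det A = 1] (mod int p)"
    using A by (simp add: SL2_def)
  have "det B = det A"
    by (simp add: B_def det_2 algebra_simps)
  then have B: "reduce_mod p B \<in> carrier (SL2 p)"
    using d by (intro reduce_mod_in_SL2 assms) simp
  have "B ** A = mat (det A)"
    by (simp add: B_def det_2 matrix_matrix_mult_def mat_def vec_eq_iff sum_2 forall_2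
        algebra_simps)
  moreover have "reduce_mod p (mat (det A)) = reduce_mod p (mat 1)"
    using d by (simp add: reduce_mod_def mat_def vec_eq_iff cong_def)
  ultimately show "\<exists>B \<in> carrier (SL2 p). B \<otimes>\<^bsub>SL2 p\<^esub> A = \<one>\<^bsub>SL2 p\<^esub>"
    using B by (intro bexI[of _ "reduce_mod p B"]) (auto simp: SL2_def reduce_mod_mult_left)
qed

definition subgroup_plus_coset_core :: "('a, 'b) monoid_scheme \<Rightarrow> 'a set \<Rightarrow> bool"
  where "subgroup_plus_coset_core G S \<longleftrightarrow>
    (\<exists>H x. subgroup H G \<and> H \<noteq> carrier G \<and> x \<in> carrier G \<and>
       generate G (H \<union> {x}) = carrier G \<and> x [^]\<^bsub>G\<^esub> (2::nat) \<in> H \<and>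
       S = H \<union> ((x <#\<^bsub>G\<^esub> H) \<inter> (H #>\<^bsub>G\<^esub> x)))"

end

theory Submission
  imports Defs "HOL-Number_Theory.Residue_Primitive_Roots"
begin

text \<open>
  Let \<open>z\<close> be a primitive sixteenth root of unity modulo \<open>p\<close>. The square of \<open>x = diag(z, 1/z)\<close> lies
  in a binary octahedral subgroup \<open>H\<close> of order 48, but \<open>x\<close> itself does not, and \<open>x\<close> normalises the
  Sylow 2-subgroup \<open>Q\<close> of \<open>H\<close>, a generalised quaternion group of order 16 that consists of the
  monomial matrices of \<open>H\<close>. The intersection of \<open>H\<close> with \<open>x H x\<close>, which is a conjugate of \<open>H\<close> because
  \<open>x\<^sup>2 \<in> H\<close>, is exactly \<open>Q\<close>; so the coset core is \<open>x Q\<close> and \<open>S = H \<union> x Q\<close> has \<open>48 + 16\<close> elements.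

  The cube of \<open>S\<close> can be read off from \<open>x\<^sup>2 \<in> H\<close> alone: two adjacent letters of the core multiply
  into \<open>H\<close>, so \<open>S\<^sup>3 = H \<union> x H x \<union> H x H\<close> (\<open>core_cubed\<close>). The first two pieces together have
  \<open>48 + 48 - 16 = 80\<close> elements, the double coset has \<open>48\<^sup>2 / 16 = 144\<close> (\<open>card_double_coset\<close>), and
  \<open>80 + 144 = 224\<close> provided that \<open>H x H\<close> is disjoint from \<open>x H x\<close>. This is seen on the product of the
  diagonal entries, which is \<open>0\<close>, \<open>1\<close> or \<open>1/2\<close> on \<open>x H x\<close>; on \<open>H x H\<close> it is \<open>(2 \<plusminus> \<surd>2)/4\<close> or else the
  exponents of \<open>z\<close> have the wrong parity (\<open>full_mult_full_irregular\<close>,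
  \<open>translate_double_coset_disjoint\<close>). These values stay apart modulo every odd prime.

  The substantial part is that \<open>H\<close> and \<open>x\<close> generate. Let \<open>B\<close> be the subgroup that they generate. If
  \<open>B\<close> contains a noncentral matrix with a double eigenvalue, then up to sign it is a transvection.
  Its powers are all the transvections with the same fixed line, because the field is prime;
  conjugation by \<open>B\<close> moves the line, two lines already give all lines, and the elementary matrices
  generate everything (\<open>subgroup_with_unipotent_is_SL2\<close>). Otherwise every noncentral element of \<open>B\<close>
  has two distinct eigenvalues, its centraliser is an abelian torus, and the tori partition the
  noncentral elements, as in Dickson's classification of the subgroups of the special linear group.
  Each conjugacy class of tori occupies a definite fraction of the group, and the class of the
  torus of \<open>x\<close>, which has at least 16 elements and is inverted by an element of \<open>H\<close>, leaves a
  remainder that no combination of classes can fill unless \<open>B\<close> normalises this torus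
  (\<open>no_large_torus\<close>); but a matrix of \<open>H\<close> with four nonzero entries does not normalise it.
\<close>

section \<open>Sets of the form H together with a coset core, and their cubes\<close>

lemma card_eq_fibre_card_times_card_image:
  assumes "finite A" and "\<And>y. y \<in> f ` A \<Longrightarrow> card {a \<in> A. f a = y} = k"
  shows "card A = k * card (f ` A)"
proof -
  have "card A = (\<Sum>y\<in>f ` A. card {a \<in> A. f a = y})"
    using sum.image_gen[OF assms(1), of "\<lambda>_. 1::nat" f] by simp
  also have "\<dots> = k * card (f ` A)"
    using assms(2) by simp
  finally show ?thesis .
qed

text \<open>
  The cube of a core consists of \<open>H\<close> and the next two sets. When \<open>x\<^sup>2 \<in> H\<close>, the set \<open>x H x\<close> is the
  conjugate \<open>x H x\<^sup>-\<^sup>1\<close>; written without an inverse, it has the shape in which it occurs as a product of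
  three elements of the core.
\<close>

definition double_coset :: "('a, 'b) monoid_scheme \<Rightarrow> 'a set \<Rightarrow> 'a \<Rightarrow> 'a set"
  where "double_coset G H x = (\<lambda>(h, k). h \<otimes>\<^bsub>G\<^esub> x \<otimes>\<^bsub>G\<^esub> k) ` (H \<times> H)"

definition two_sided_translate :: "('a, 'b) monoid_scheme \<Rightarrow> 'a set \<Rightarrow> 'a \<Rightarrow> 'a set"
  where "two_sided_translate G H x = (\<lambda>h. x \<otimes>\<^bsub>G\<^esub> h \<otimes>\<^bsub>G\<^esub> x) ` H"

context group
begin

lemma mem_set_mult_iff: "y \<in> A <#> B \<longleftrightarrow> (\<exists>a\<in>A. \<exists>b\<in>B. y = a \<otimes> b)"
  by (auto simp: set_mult_def)

text \<open>
  An element of the core can be written both as \<open>x h\<close> and as \<open>k x\<close> with \<open>h, k \<in> H\<close>. Two adjacent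
  core letters therefore contain the factor \<open>x\<^sup>2\<close> and collapse into \<open>H\<close>, and a single core letter can
  be made to expose its \<open>x\<close> on the side where it is needed.
\<close>

lemma core_cubed:
  assumes H: "subgroup H G" and x: "x \<in> carrier G" and xx: "x \<otimes> x \<in> H"
  defines "S \<equiv> H \<union> ((x <# H) \<inter> (H #> x))"
  shows "S <#> S <#> S = H \<union> double_coset G H x \<union> two_sided_translate G H x" (is "_ = ?R")
proof
  interpret H: subgroup H G by (rule H)
  note [simp] = H.mem_carrier x
  note [intro] = H.m_closed
  let ?C = "(x <# H) \<inter> (H #> x)"
  have C: "\<exists>h\<in>H. \<exists>k\<in>H. c = x \<otimes> h \<and> c = k \<otimes> x" if "c \<in> ?C" for c
    using that by (auto simp: l_coset_def r_coset_def)
  have dcI: "h \<otimes> x \<otimes> k \<in> double_coset G H x" if "h \<in> H" "k \<in> H" for h k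
    using that by (force simp: double_coset_def)
  have dcI1: "h \<otimes> x \<in> double_coset G H x" if "h \<in> H" for h
    using dcI[OF that H.one_closed] that by simp
  have dcI2: "x \<otimes> k \<in> double_coset G H x" if "k \<in> H" for k
    using dcI[OF H.one_closed that] that by simp
  have trI: "x \<otimes> h \<otimes> x \<in> two_sided_translate G H x" if "h \<in> H" for h
    using that by (force simp: two_sided_translate_def)
  have CC: "c \<otimes> d \<in> H" if c: "c \<in> ?C" and d: "d \<in> ?C" for c d
  proof -
    obtain k where k: "k \<in> H" "c = k \<otimes> x" using C[OF c] by blast
    obtain h where h: "h \<in> H" "d = x \<otimes> h" using C[OF d] by blast
    have "c \<otimes> d = k \<otimes> (x \<otimes> x) \<otimes> h" using h k by (simp add: m_assoc)
    then show ?thesis using h k xx by auto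
  qed
  show "S <#> S <#> S \<subseteq> ?R"
  proof
    fix y assume "y \<in> S <#> S <#> S"
    then obtain a b c where abc: "a \<in> S" "b \<in> S" "c \<in> S" and y: "y = a \<otimes> b \<otimes> c"
      by (auto simp: mem_set_mult_iff)
    have S: "s \<in> H \<or> s \<in> ?C" if "s \<in> S" for s using that by (auto simp: S_def)
    from S[OF abc(1)] S[OF abc(2)] S[OF abc(3)] show "y \<in> ?R"
    proof (elim disjE)
      assume "a \<in> H" "b \<in> H" "c \<in> H" then show ?thesis by (auto simp: y)
    next
      assume "a \<in> H" "b \<in> H" and c: "c \<in> ?C"
      moreover obtain k where "k \<in> H" "c = k \<otimes> x" using C[OF c] by blast
      ultimately show ?thesis using dcI1[of "a \<otimes> b \<otimes> k"] by (auto simp: y m_assoc)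
    next
      assume "a \<in> H" "c \<in> H" and c: "b \<in> ?C"
      moreover obtain k where "k \<in> H" "b = k \<otimes> x" using C[OF c] by blast
      ultimately show ?thesis using dcI[of "a \<otimes> k" c] by (auto simp: y m_assoc)
    next
      assume a: "a \<in> H" and c: "b \<in> ?C" "c \<in> ?C"
      have "b \<in> carrier G" "c \<in> carrier G" using C[OF c(1)] C[OF c(2)] by auto
      then have "y = a \<otimes> (b \<otimes> c)" using a by (simp add: y m_assoc)
      then show ?thesis using a CC[OF c] by auto
    next
      assume "b \<in> H" "c \<in> H" and c: "a \<in> ?C"
      moreover obtain k where "k \<in> H" "a = x \<otimes> k" using C[OF c] by blast
      ultimately show ?thesis using dcI2[of "k \<otimes> b \<otimes> c"] by (auto simp: y m_assoc)
    next
      assume b: "b \<in> H" and c: "a \<in> ?C" "c \<in> ?C"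
      obtain h where h: "h \<in> H" "a = x \<otimes> h" using C[OF c(1)] by blast
      obtain k where k: "k \<in> H" "c = k \<otimes> x" using C[OF c(2)] by blast
      have "y = x \<otimes> (h \<otimes> b \<otimes> k) \<otimes> x" using h k b by (simp add: y m_assoc)
      then show ?thesis using trI[of "h \<otimes> b \<otimes> k"] h k b by auto
    next
      assume "a \<in> ?C" "b \<in> ?C" "c \<in> H"
      then show ?thesis using CC[of a b] by (auto simp: y)
    next
      assume c: "a \<in> ?C" "b \<in> ?C" "c \<in> ?C"
      obtain k where k: "k \<in> H" "c = k \<otimes> x" using C[OF c(3)] by blast
      have "y = a \<otimes> b \<otimes> k \<otimes> x" using k C[OF c(1)] C[OF c(2)] by (auto simp: y m_assoc)
      then show ?thesis using dcI1[of "a \<otimes> b \<otimes> k"] CC[OF c(1,2)] k by auto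
    qed
  qed
  have xC: "x \<in> S"
    using H.one_closed by (force simp: S_def l_coset_def r_coset_def)
  have SSS: "a \<otimes> b \<otimes> c \<in> S <#> S <#> S" if "a \<in> S" "b \<in> S" "c \<in> S" for a b c
    using that unfolding set_mult_def by blast
  have HS: "h \<in> S" if "h \<in> H" for h using that by (simp add: S_def)
  show "?R \<subseteq> S <#> S <#> S"
  proof
    fix y assume "y \<in> ?R"
    then consider "y \<in> H" | h k where "h \<in> H" "k \<in> H" "y = h \<otimes> x \<otimes> k"
      | h where "h \<in> H" "y = x \<otimes> h \<otimes> x"
      by (auto simp: double_coset_def two_sided_translate_def)
    then show "y \<in> S <#> S <#> S"
    proof cases
      case 1
      then show ?thesis using SSS[of \<one> \<one> y] HS by simp
    qed (use HS xC SSS in auto)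
  qed
qed

text \<open>
  Right multiplication by \<open>x\<close> turns the core into the intersection of \<open>H\<close> with its conjugate.
\<close>

lemma card_coset_core:
  assumes H: "subgroup H G" and x: "x \<in> carrier G" and xx: "x \<otimes> x \<in> H"
  shows "card ((x <# H) \<inter> (H #> x)) = card (H \<inter> two_sided_translate G H x)"
proof (rule bij_betw_same_card[of "\<lambda>c. c \<otimes> x"], rule bij_betw_imageI)
  interpret H: subgroup H G by (rule H)
  note [simp] = H.mem_carrier x
  show "inj_on (\<lambda>c. c \<otimes> x) ((x <# H) \<inter> (H #> x))"
    by (rule inj_onI) (auto simp: l_coset_def r_coset_def)
  show "(\<lambda>c. c \<otimes> x) ` ((x <# H) \<inter> (H #> x)) = H \<inter> two_sided_translate G H x"
  proof (intro Set.set_eqI iffI)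
    fix d assume "d \<in> (\<lambda>c. c \<otimes> x) ` ((x <# H) \<inter> (H #> x))"
    then obtain h k where "h \<in> H" "k \<in> H" "x \<otimes> h = k \<otimes> x" and d: "d = x \<otimes> h \<otimes> x"
      by (auto simp: l_coset_def r_coset_def)
    then have "d = k \<otimes> (x \<otimes> x)" by (simp add: m_assoc)
    with xx \<open>k \<in> H\<close> have "d \<in> H" by auto
    with d \<open>h \<in> H\<close> show "d \<in> H \<inter> two_sided_translate G H x"
      by (auto simp: two_sided_translate_def)
  next
    fix d assume "d \<in> H \<inter> two_sided_translate G H x"
    then obtain h where d: "d \<in> H" and h: "h \<in> H" "d = x \<otimes> h \<otimes> x"
      by (auto simp: two_sided_translate_def)
    have "x \<otimes> h = d \<otimes> inv (x \<otimes> x) \<otimes> x"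
      using h by (simp add: m_assoc inv_mult_group)
    moreover have "d \<otimes> inv (x \<otimes> x) \<in> H" using d xx by auto
    ultimately have "x \<otimes> h \<in> (x <# H) \<inter> (H #> x)"
      using h by (auto simp: l_coset_def r_coset_def)
    then show "d \<in> (\<lambda>c. c \<otimes> x) ` ((x <# H) \<inter> (H #> x))" using h by auto
  qed
qed

text \<open>
  The map \<open>(h, k) \<mapsto> h x k\<close> onto the double coset has fibres \<open>(h d, x\<^sup>-\<^sup>1 d\<^sup>-\<^sup>1 x k)\<close>, where \<open>d\<close> runs through
  the intersection of \<open>H\<close> with \<open>x H x\<^sup>-\<^sup>1 = x H x\<close>.
\<close>

lemma card_double_coset:
  assumes H: "subgroup H G" and fin: "finite H" and x: "x \<in> carrier G" and xx: "x \<otimes> x \<in> H"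
  shows "card (H \<inter> two_sided_translate G H x) * card (double_coset G H x) = card H * card H"
proof -
  interpret H: subgroup H G by (rule H)
  note [simp] = H.mem_carrier x
  let ?f = "\<lambda>(h, k). h \<otimes> x \<otimes> k" and ?D = "H \<inter> two_sided_translate G H x"
  have "card {a \<in> H \<times> H. ?f a = y} = card ?D" if "y \<in> ?f ` (H \<times> H)" for y
  proof -
    from that obtain h k where hk: "h \<in> H" "k \<in> H" "y = h \<otimes> x \<otimes> k" by auto
    have conj: "inv x \<otimes> inv d \<otimes> x \<otimes> k \<in> H" if d: "d \<in> ?D" for d
    proof -
      obtain m where m: "m \<in> H" "d = x \<otimes> m \<otimes> x"
        using d by (auto simp: two_sided_translate_def)
      have "inv x \<otimes> inv d \<otimes> x \<otimes> k = inv (x \<otimes> x) \<otimes> inv m \<otimes> k"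
        using m hk by (simp add: m_assoc inv_mult_group)
      then show ?thesis using xx m hk by auto
    qed
    have "bij_betw (\<lambda>d. (h \<otimes> d, inv x \<otimes> inv d \<otimes> x \<otimes> k)) ?D {a \<in> H \<times> H. ?f a = y}"
    proof (rule bij_betw_imageI)
      show "inj_on (\<lambda>d. (h \<otimes> d, inv x \<otimes> inv d \<otimes> x \<otimes> k)) ?D"
        using hk by (auto intro!: inj_onI)
      show "(\<lambda>d. (h \<otimes> d, inv x \<otimes> inv d \<otimes> x \<otimes> k)) ` ?D = {a \<in> H \<times> H. ?f a = y}"
      proof (intro Set.set_eqI iffI)
        fix a assume "a \<in> (\<lambda>d. (h \<otimes> d, inv x \<otimes> inv d \<otimes> x \<otimes> k)) ` ?D"
        then obtain d where d: "d \<in> ?D" "a = (h \<otimes> d, inv x \<otimes> inv d \<otimes> x \<otimes> k)" by blast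
        have "h \<otimes> d \<otimes> x \<otimes> (inv x \<otimes> inv d \<otimes> x \<otimes> k) = y"
          using d(1) hk by (simp add: m_assoc) (simp flip: m_assoc)
        then show "a \<in> {a \<in> H \<times> H. ?f a = y}"
          using d hk conj[OF d(1)] by auto
      next
        fix a assume "a \<in> {a \<in> H \<times> H. ?f a = y}"
        then obtain h' k' where a: "a = (h', k')" "h' \<in> H" "k' \<in> H"
          and e: "h' \<otimes> x \<otimes> k' = h \<otimes> x \<otimes> k" using hk by auto
        define d where "d = inv h \<otimes> h'"
        have dH: "d \<in> H" using hk a by (auto simp: d_def)
        have k': "k' = inv x \<otimes> inv d \<otimes> x \<otimes> k"
        proof -
          have "h' \<otimes> x \<in> carrier G" "k' \<in> carrier G" using a by auto
          then have "k' = inv (h' \<otimes> x) \<otimes> (h \<otimes> x \<otimes> k)"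
            unfolding e[symmetric] by (metis inv_closed l_inv l_one m_assoc)
          also have "\<dots> = inv x \<otimes> inv d \<otimes> x \<otimes> k"
            using a hk by (simp add: d_def m_assoc inv_mult_group)
          finally show ?thesis .
        qed
        have xk: "x \<otimes> k' = inv d \<otimes> x \<otimes> k"
          using dH hk by (simp add: k' m_assoc) (simp flip: m_assoc)
        have "d \<otimes> x \<otimes> k' = x \<otimes> k"
          using a dH hk by (simp add: m_assoc xk) (simp flip: m_assoc)
        then have "d \<otimes> x = x \<otimes> k \<otimes> inv k'"
          using a dH hk by (metis H.mem_carrier inv_solve_right m_closed x)
        then have "d = x \<otimes> k \<otimes> inv k' \<otimes> inv x"
          using a dH hk by (metis H.mem_carrier inv_closed inv_solve_right m_closed x)
        then have "d = x \<otimes> (k \<otimes> inv k' \<otimes> inv (x \<otimes> x)) \<otimes> x"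
          using a hk by (simp add: m_assoc inv_mult_group)
        moreover have "k \<otimes> inv k' \<otimes> inv (x \<otimes> x) \<in> H" using a hk xx by auto
        ultimately have "d \<in> ?D" using dH by (auto simp: two_sided_translate_def)
        moreover have "h' = h \<otimes> d"
          using a hk by (simp add: d_def flip: m_assoc)
        ultimately show "a \<in> (\<lambda>d. (h \<otimes> d, inv x \<otimes> inv d \<otimes> x \<otimes> k)) ` ?D"
          using a k' by auto
      qed
    qed
    from bij_betw_same_card[OF this] show ?thesis by simp
  qed
  from card_eq_fibre_card_times_card_image[OF _ this] fin
  show ?thesis by (simp add: double_coset_def card_cartesian_product)
qed

text \<open>
  Stated without division: \<open>card (S\<^sup>3) = (2 card H - q) + (card H)\<^sup>2 / q\<close>.
\<close>

lemma card_core_and_cube: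
  assumes H: "subgroup H G" and fin: "finite H" and x: "x \<in> carrier G" "x \<notin> H"
    and xx: "x \<otimes> x \<in> H"
    and disj: "two_sided_translate G H x \<inter> double_coset G H x = {}"
    and q: "q = card (H \<inter> two_sided_translate G H x)"
  defines "S \<equiv> H \<union> ((x <# H) \<inter> (H #> x))"
  shows "card S = card H + q"
    and "q * card (S <#> S <#> S) = q * (2 * card H - q) + card H * card H"
proof -
  interpret H: subgroup H G by (rule H)
  note [simp] = H.mem_carrier x(1)
  let ?K = "two_sided_translate G H x" and ?D = "double_coset G H x"
  have finK: "finite ?K" and finD: "finite ?D"
    using fin by (simp_all add: two_sided_translate_def double_coset_def)
  have xh: "x \<in> H" if "x \<otimes> h \<in> H" "h \<in> H" for h
  proof -
    have "x = x \<otimes> h \<otimes> inv h" using that by (simp add: m_assoc)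
    then show ?thesis using that by (metis H.m_closed H.m_inv_closed)
  qed
  have "H \<inter> ((x <# H) \<inter> (H #> x)) = {}"
    using xh x(2) by (auto simp: l_coset_def)
  moreover have "finite (x <# H)"
    using fin by (simp add: l_coset_def)
  ultimately show "card S = card H + q"
    unfolding S_def using fin card_coset_core[OF H x(1) xx]
    by (subst card_Un_disjoint) (auto simp: q)
  have "H \<inter> ?D = {}"
  proof (intro equals0I)
    fix y assume "y \<in> H \<inter> ?D"
    then obtain h k where hk: "h \<in> H" "k \<in> H" "h \<otimes> x \<otimes> k \<in> H"
      by (auto simp: double_coset_def)
    have "x \<otimes> k = inv h \<otimes> (h \<otimes> x \<otimes> k)"
      using hk(1,2) by (simp flip: m_assoc)
    also have "\<dots> \<in> H" using hk by auto
    finally show False using xh hk x(2) by blast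
  qed
  then have "card (S <#> S <#> S) = card (H \<union> ?K) + card ?D"
    unfolding S_def core_cubed[OF H x(1) xx]
    using fin finK finD disj by (subst card_Un_disjoint[symmetric]) (auto simp: Un_ac)
  moreover have "card ?K = card H"
    unfolding two_sided_translate_def by (rule card_image) (auto intro!: inj_onI)
  then have "card (H \<union> ?K) = 2 * card H - q"
    using card_Un_Int[OF fin finK] by (simp add: q)
  ultimately show "q * card (S <#> S <#> S) = q * (2 * card H - q) + card H * card H"
    using card_double_coset[OF H fin x(1) xx] by (simp add: q distrib_left)
qed

end

section \<open>Class equation of a group partitioned by tori\<close>

definition (in group) conjugate :: "'a \<Rightarrow> 'a \<Rightarrow> 'a"
  where "conjugate g a = g \<otimes> a \<otimes> inv g"

context group begin

lemma conjugate_closed [simp]: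
  "g \<in> carrier G \<Longrightarrow> a \<in> carrier G \<Longrightarrow> conjugate g a \<in> carrier G"
  by (simp add: conjugate_def)

lemma conjugate_mult:
  assumes "g \<in> carrier G" "a \<in> carrier G" "b \<in> carrier G"
  shows "conjugate g (a \<otimes> b) = conjugate g a \<otimes> conjugate g b"
proof -
  have "conjugate g a \<otimes> conjugate g b = g \<otimes> a \<otimes> (inv g \<otimes> g) \<otimes> b \<otimes> inv g"
    using assms by (simp only: conjugate_def m_assoc inv_closed m_closed)
  then show ?thesis using assms by (simp add: conjugate_def m_assoc)
qed

lemma conjugate_conjugate:
  "g \<in> carrier G \<Longrightarrow> h \<in> carrier G \<Longrightarrow> a \<in> carrier G \<Longrightarrow>
    conjugate g (conjugate h a) = conjugate (g \<otimes> h) a"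
  by (simp add: conjugate_def m_assoc inv_mult_group)

lemma conjugate_one [simp]: "a \<in> carrier G \<Longrightarrow> conjugate \<one> a = a"
  by (simp add: conjugate_def)

lemma conjugate_inv_cancel [simp]:
  "g \<in> carrier G \<Longrightarrow> a \<in> carrier G \<Longrightarrow> conjugate (inv g) (conjugate g a) = a"
  "g \<in> carrier G \<Longrightarrow> a \<in> carrier G \<Longrightarrow> conjugate g (conjugate (inv g) a) = a"
  by (simp_all add: conjugate_conjugate)

lemma conjugate_eq_iff:
  "g \<in> carrier G \<Longrightarrow> a \<in> carrier G \<Longrightarrow> b \<in> carrier G \<Longrightarrow> conjugate g a = conjugate g b \<longleftrightarrow> a = b"
  by (metis conjugate_inv_cancel(1))

lemma conjugate_eq_iff_commute:
  assumes "g \<in> carrier G" "a \<in> carrier G" "b \<in> carrier G"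
  shows "conjugate g a = b \<longleftrightarrow> g \<otimes> a = b \<otimes> g"
  using assms by (metis conjugate_def inv_solve_right m_closed)

end

text \<open>
  The abstract form of a finite subgroup of the special linear group of degree two that contains
  \<open>- 1\<close> and in which all noncentral elements have distinct eigenvalues; \<open>Z\<close> is \<open>{1, - 1}\<close>. The last
  assumption records that conjugate elements of one torus have the same pair of eigenvalues, hence
  agree or are inverse to each other. The assumptions avoid inverses, so that they transfer without
  change from a group to its subgroups.
\<close>

locale torus_partitioned_group = group +
  fixes Z
  assumes fin: "finite (carrier G)"
    and Z: "subgroup Z G" and card_Z: "card Z = 2"
    and central: "z \<in> Z \<Longrightarrow> g \<in> carrier G \<Longrightarrow> z \<otimes> g = g \<otimes> z"
    and commute_trans: "\<lbrakk>u \<in> carrier G - Z; v \<in> carrier G; w \<in> carrier G;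
          u \<otimes> v = v \<otimes> u; u \<otimes> w = w \<otimes> u\<rbrakk> \<Longrightarrow> v \<otimes> w = w \<otimes> v"
    and conjugate_commuting: "\<lbrakk>u \<in> carrier G - Z; g \<in> carrier G; v \<in> carrier G;
          g \<otimes> u = v \<otimes> g; u \<otimes> v = v \<otimes> u\<rbrakk> \<Longrightarrow> v = u \<or> u \<otimes> v = \<one>"
begin

text \<open>
  For noncentral \<open>u\<close>, the third set collects the noncentral elements of all conjugates of the torus
  of \<open>u\<close>.
\<close>

definition torus where "torus u = {v \<in> carrier G. u \<otimes> v = v \<otimes> u}"

definition torus_normalizer where
  "torus_normalizer u = {g \<in> carrier G. conjugate g u \<in> torus u}"

definition torus_class where
  "torus_class u = (\<lambda>(g, v). conjugate g v) ` (carrier G \<times> (torus u - Z))"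

lemma Z_subset: "Z \<subseteq> carrier G"
  using Z by (rule subgroup.subset)

lemma Z_subset_torus: "u \<in> carrier G \<Longrightarrow> Z \<subseteq> torus u"
  using Z_subset by (auto simp: torus_def intro: central[symmetric])

lemma finite_torus: "finite (torus u)" and finite_torus_class: "finite (torus_class u)"
  and finite_torus_normalizer: "finite (torus_normalizer u)"
  using fin by (simp_all add: torus_def torus_class_def torus_normalizer_def)

lemma commute_conjugate_iff:
  assumes "g \<in> carrier G" "a \<in> carrier G" "b \<in> carrier G"
  shows "conjugate g a \<otimes> conjugate g b = conjugate g b \<otimes> conjugate g a \<longleftrightarrow> a \<otimes> b = b \<otimes> a"
  using assms by (simp flip: conjugate_mult add: conjugate_eq_iff)

lemma conjugate_Z: "z \<in> Z \<Longrightarrow> g \<in> carrier G \<Longrightarrow> conjugate g z = z"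
  using Z_subset central by (subst conjugate_eq_iff_commute) auto

lemma conjugate_notin_Z:
  assumes "a \<in> carrier G - Z" "g \<in> carrier G"
  shows "conjugate g a \<in> carrier G - Z"
proof -
  have "conjugate g a \<notin> Z"
  proof
    assume "conjugate g a \<in> Z"
    then have "conjugate (inv g) (conjugate g a) = conjugate g a"
      using assms by (intro conjugate_Z) auto
    then show False using assms \<open>conjugate g a \<in> Z\<close> by auto
  qed
  then show ?thesis using assms by simp
qed

text \<open>
  Commuting is an equivalence relation on the noncentral elements, and so is commuting up to
  conjugacy; the classes of the latter relation are the torus classes, which are therefore disjoint
  or equal.
\<close>

lemma mem_torus_class_iff:
  assumes u: "u \<in> carrier G - Z"
  shows "v \<in> torus_class u \<longleftrightarrow>
    v \<in> carrier G - Z \<and> (\<exists>g\<in>carrier G. conjugate g u \<otimes> v = v \<otimes> conjugate g u)"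
proof
  assume "v \<in> torus_class u"
  then obtain g w where g: "g \<in> carrier G" "w \<in> carrier G - Z" "u \<otimes> w = w \<otimes> u" "v = conjugate g w"
    by (auto simp: torus_class_def torus_def)
  with u have "conjugate g u \<otimes> v = v \<otimes> conjugate g u"
    by (simp add: commute_conjugate_iff)
  with g conjugate_notin_Z show "v \<in> carrier G - Z \<and> (\<exists>g\<in>carrier G. conjugate g u \<otimes> v = v \<otimes> conjugate g u)"
    by blast
next
  assume "v \<in> carrier G - Z \<and> (\<exists>g\<in>carrier G. conjugate g u \<otimes> v = v \<otimes> conjugate g u)"
  then obtain g where v: "v \<in> carrier G - Z" and g: "g \<in> carrier G"
    and e: "conjugate g u \<otimes> v = v \<otimes> conjugate g u" by blast
  define w where "w = conjugate (inv g) v"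
  have vw: "v = conjugate g w" using v g by (simp add: w_def)
  have w: "w \<in> carrier G - Z" using v g by (simp only: w_def conjugate_notin_Z inv_closed)
  have "u \<otimes> w = w \<otimes> u"
    using e g w u by (simp add: vw commute_conjugate_iff)
  then show "v \<in> torus_class u"
    using vw w g by (force simp: torus_class_def torus_def)
qed

lemma torus_class_sym:
  assumes "u \<in> carrier G - Z" "v \<in> torus_class u"
  shows "u \<in> torus_class v"
proof -
  obtain g where v: "v \<in> carrier G - Z" and g: "g \<in> carrier G"
    and e: "conjugate g u \<otimes> v = v \<otimes> conjugate g u"
    using assms by (auto simp: mem_torus_class_iff)
  have "conjugate (inv g) (conjugate g u) \<otimes> conjugate (inv g) v
      = conjugate (inv g) v \<otimes> conjugate (inv g) (conjugate g u)"
    using v g assms e by (subst commute_conjugate_iff) auto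
  then have "conjugate (inv g) v \<otimes> u = u \<otimes> conjugate (inv g) v"
    using g assms(1) by simp
  with g assms(1) show ?thesis
    using v by (subst mem_torus_class_iff) auto
qed

lemma torus_class_trans:
  assumes u: "u \<in> carrier G - Z" and v: "v \<in> torus_class u" and w: "w \<in> torus_class v"
  shows "w \<in> torus_class u"
proof -
  obtain g where vZ: "v \<in> carrier G - Z" and g: "g \<in> carrier G"
    and e: "conjugate g u \<otimes> v = v \<otimes> conjugate g u"
    using u v by (auto simp: mem_torus_class_iff)
  obtain h where wZ: "w \<in> carrier G - Z" and h: "h \<in> carrier G"
    and e': "conjugate h v \<otimes> w = w \<otimes> conjugate h v"
    using vZ w by (auto simp: mem_torus_class_iff)
  have "conjugate h v \<otimes> conjugate (h \<otimes> g) u = conjugate (h \<otimes> g) u \<otimes> conjugate h v"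
    using u vZ g h e by (simp flip: conjugate_conjugate add: commute_conjugate_iff)
  from commute_trans[OF conjugate_notin_Z[OF vZ h] _ _ this e']
  have "conjugate (h \<otimes> g) u \<otimes> w = w \<otimes> conjugate (h \<otimes> g) u"
    using u wZ g h by simp
  then show ?thesis using u wZ g h by (subst mem_torus_class_iff) auto
qed

lemma torus_class_subset: "u \<in> carrier G - Z \<Longrightarrow> torus_class u \<subseteq> carrier G - Z"
  using mem_torus_class_iff by blast

text \<open>
  All fibres of \<open>(g, v) \<mapsto> g v g\<^sup>-\<^sup>1\<close> are translates of the normaliser: \<open>g n\<close> again conjugates an element
  of the torus to \<open>g v g\<^sup>-\<^sup>1\<close> if and only if \<open>n\<^sup>-\<^sup>1 v n\<close> lies in the torus, and commutative tori
  that share a noncentral element coincide.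
\<close>

lemma card_torus_class:
  assumes u: "u \<in> carrier G - Z"
  shows "card (torus_normalizer u) * card (torus_class u) = order G * (card (torus u) - 2)"
proof -
  let ?A = "carrier G \<times> (torus u - Z)" and ?f = "\<lambda>(g, v). conjugate g v"
  have "card {a \<in> ?A. ?f a = y} = card (torus_normalizer u)" if y: "y \<in> ?f ` ?A" for y
  proof -
    obtain g v where g: "g \<in> carrier G" and v: "v \<in> carrier G - Z" "u \<otimes> v = v \<otimes> u"
      and y: "y = conjugate g v"
      using y by (auto simp: torus_def)
    let ?h = "\<lambda>n. (g \<otimes> n, conjugate (inv n) v)"
    have N: "n \<in> torus_normalizer u \<longleftrightarrow> conjugate (inv n) v \<in> torus u - Z"
      if n: "n \<in> carrier G" for n
    proof -
      have "u \<otimes> conjugate (inv n) v = conjugate (inv n) v \<otimes> u \<longleftrightarrow>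
          conjugate n u \<otimes> v = v \<otimes> conjugate n u"
        using commute_conjugate_iff[of n u "conjugate (inv n) v"] n u v by simp
      also have "\<dots> \<longleftrightarrow> conjugate n u \<otimes> u = u \<otimes> conjugate n u"
      proof
        assume "conjugate n u \<otimes> v = v \<otimes> conjugate n u"
        from commute_trans[OF v(1) _ _ v(2)[symmetric] this[symmetric]] show "conjugate n u \<otimes> u = u \<otimes> conjugate n u"
          using u n by simp
      next
        assume "conjugate n u \<otimes> u = u \<otimes> conjugate n u"
        from commute_trans[OF u _ _ this[symmetric] v(2)] show "conjugate n u \<otimes> v = v \<otimes> conjugate n u"
          using u n v by simp
      qed
      finally show ?thesis
        using n u v conjugate_notin_Z[of v "inv n"] by (auto simp: torus_normalizer_def torus_def)
    qed
    have "bij_betw ?h (torus_normalizer u) {a \<in> ?A. ?f a = y}"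
    proof (rule bij_betw_imageI)
      show "inj_on ?h (torus_normalizer u)"
        using g by (auto intro!: inj_onI simp: torus_normalizer_def)
      show "?h ` torus_normalizer u = {a \<in> ?A. ?f a = y}"
      proof (intro Set.set_eqI iffI)
        fix a assume "a \<in> ?h ` torus_normalizer u"
        then obtain n where n: "n \<in> torus_normalizer u" "a = ?h n" by blast
        then have nG: "n \<in> carrier G" by (simp add: torus_normalizer_def)
        have "conjugate (g \<otimes> n) (conjugate (inv n) v) = y"
          using g nG v by (simp flip: conjugate_conjugate add: y)
        then show "a \<in> {a \<in> ?A. ?f a = y}"
          using n N[OF nG] nG g by auto
      next
        fix a assume "a \<in> {a \<in> ?A. ?f a = y}"
        then obtain g' v' where a: "a = (g', v')" "g' \<in> carrier G" "v' \<in> torus u - Z"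
          and e: "conjugate g' v' = conjugate g v" by (auto simp: y)
        then have v': "v' \<in> carrier G" by (simp add: torus_def)
        define n where "n = inv g \<otimes> g'"
        have n: "n \<in> carrier G" "g' = g \<otimes> n"
          using g a by (simp_all add: n_def) (simp flip: m_assoc)
        then have "conjugate n v' = v"
          using e g v v' by (simp flip: conjugate_conjugate add: conjugate_eq_iff)
        then have "v' = conjugate (inv n) v" using n v' by force
        moreover from this have "n \<in> torus_normalizer u" using N[OF n(1)] a by simp
        ultimately show "a \<in> ?h ` torus_normalizer u" using a n by auto
      qed
    qed
    from bij_betw_same_card[OF this] show ?thesis by simp
  qed
  from card_eq_fibre_card_times_card_image[OF _ this]
  have "card ?A = card (torus_normalizer u) * card (torus_class u)"
    using fin finite_torus by (simp add: torus_class_def)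
  moreover have "Z \<subseteq> torus u"
    using Z_subset_torus u by blast
  ultimately show ?thesis
    using card_Z by (simp add: card_cartesian_product order_def card_Diff_subset
        finite_subset[OF Z_subset fin])
qed

lemma subgroup_torus: "u \<in> carrier G \<Longrightarrow> subgroup (torus u) G"
proof (unfold_locales, goal_cases)
  case (2 v w)
  then have *: "v \<in> carrier G" "w \<in> carrier G" "u \<otimes> v = v \<otimes> u" "u \<otimes> w = w \<otimes> u"
    by (auto simp: torus_def)
  then have "u \<otimes> (v \<otimes> w) = v \<otimes> w \<otimes> u"
    using 2(1) by (metis m_assoc)
  then show ?case using * by (simp add: torus_def)
next
  case (4 v)
  then have *: "v \<in> carrier G" "u \<otimes> v = v \<otimes> u" by (auto simp: torus_def)
  then have "conjugate v u = u"
    using 4(1) by (subst conjugate_eq_iff_commute) auto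
  then have "conjugate (inv v) u = u"
    using conjugate_inv_cancel(1)[of v u] * 4(1) by simp
  then have "u \<otimes> inv v = inv v \<otimes> u"
    using * 4(1) by (subst (asm) conjugate_eq_iff_commute) auto
  then show ?case using * by (simp add: torus_def)
qed (auto simp: torus_def)

text \<open>
  The bound and the parity exclude five as well as three; both exclusions matter for the gaps in
  \<open>density_values\<close>.
\<close>

lemma card_torus:
  assumes u: "u \<in> carrier G - Z"
  shows "card (torus u) = 4 \<or> 6 \<le> card (torus u)" and "even (card (torus u))"
proof -
  have sub: "insert u Z \<subseteq> torus u"
    using Z_subset_torus[of u] u by (auto simp: torus_def)
  interpret T: group "G\<lparr>carrier := torus u\<rparr>"
    using subgroup_torus u by (intro subgroup_imp_group) auto
  have "subgroup Z (G\<lparr>carrier := torus u\<rparr>)"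
    using sub Z subgroup_torus u by (intro subgroup_incl) auto
  from T.lagrange[OF this] have "card (rcosets\<^bsub>G\<lparr>carrier := torus u\<rparr>\<^esub> Z) * card Z = card (torus u)"
    by (simp add: order_def)
  then have "card Z dvd card (torus u)"
    by (rule dvdI[OF sym, OF trans[OF mult.commute]])
  then show e: "even (card (torus u))" by (simp add: card_Z)
  have "card (insert u Z) = 3"
    using u card_Z finite_subset[OF Z_subset fin] by simp
  with card_mono[OF finite_torus sub] have "3 \<le> card (torus u)" by simp
  with e show "card (torus u) = 4 \<or> 6 \<le> card (torus u)" by presburger
qed

lemma torus_subset_normalizer: "u \<in> carrier G \<Longrightarrow> torus u \<subseteq> torus_normalizer u"
proof
  fix g assume u: "u \<in> carrier G" and g: "g \<in> torus u"
  then have "conjugate g u = u"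
    by (subst conjugate_eq_iff_commute) (auto simp: torus_def)
  with u g show "g \<in> torus_normalizer u" by (auto simp: torus_normalizer_def torus_def)
qed

text \<open>
  Elements of the normaliser outside the torus invert \<open>u\<close>, so any two of them differ by an element
  that centralises \<open>u\<close>.
\<close>

lemma card_torus_normalizer_double:
  assumes u: "u \<in> carrier G - Z" and g: "g \<in> torus_normalizer u - torus u"
  shows "card (torus_normalizer u) = 2 * card (torus u)"
proof -
  have inv: "conjugate h u = inv u" if h: "h \<in> torus_normalizer u - torus u" for h
  proof -
    have hG: "h \<in> carrier G" using h by (simp add: torus_normalizer_def)
    have "conjugate h u = u \<or> u \<otimes> conjugate h u = \<one>"
    proof (rule conjugate_commuting[OF u hG])
      show "h \<otimes> u = conjugate h u \<otimes> h"
        using u hG by (subst conjugate_eq_iff_commute[symmetric]) auto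
    qed (use h u hG in \<open>auto simp: torus_normalizer_def torus_def\<close>)
    moreover have "conjugate h u \<noteq> u"
      using h hG u by (subst conjugate_eq_iff_commute) (auto simp: torus_def)
    ultimately show ?thesis
      using u hG inv_equality[of "conjugate h u" u] by (metis DiffE conjugate_closed inv_comm)
  qed
  have gG: "g \<in> carrier G" using g by (simp add: torus_normalizer_def)
  have "bij_betw (\<lambda>c. g \<otimes> c) (torus u) (torus_normalizer u - torus u)"
  proof (rule bij_betw_imageI)
    show "inj_on (\<lambda>c. g \<otimes> c) (torus u)"
      using gG by (auto intro!: inj_onI simp: torus_def)
    show "(\<lambda>c. g \<otimes> c) ` torus u = torus_normalizer u - torus u"
    proof (intro Set.set_eqI iffI)
      fix h assume "h \<in> (\<lambda>c. g \<otimes> c) ` torus u"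
      then obtain c where c: "c \<in> carrier G" "u \<otimes> c = c \<otimes> u" "h = g \<otimes> c"
        by (auto simp: torus_def)
      have cu: "conjugate c u = u"
        using c u by (subst conjugate_eq_iff_commute) auto
      have hu: "conjugate h u = inv u"
        using c u gG cu inv[OF g] by (simp flip: conjugate_conjugate)
      have "conjugate g u \<noteq> u"
        using g gG u by (subst conjugate_eq_iff_commute) (auto simp: torus_def)
      then have "conjugate h u \<noteq> u" using hu inv[OF g] by simp
      then have "h \<notin> torus u"
        using c gG u by (subst (asm) conjugate_eq_iff_commute) (auto simp: torus_def)
      moreover have "h \<in> torus_normalizer u"
        using hu c gG u by (simp add: torus_normalizer_def torus_def)
      ultimately show "h \<in> torus_normalizer u - torus u" by simp
    next
      fix h assume h: "h \<in> torus_normalizer u - torus u"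
      then have hG: "h \<in> carrier G" by (simp add: torus_normalizer_def)
      have "conjugate (inv g \<otimes> h) u = u"
        using gG hG u inv[OF h] by (simp flip: conjugate_conjugate inv[OF g])
      then have "inv g \<otimes> h \<in> torus u"
        using gG hG u by (subst (asm) conjugate_eq_iff_commute) (auto simp: torus_def)
      moreover have "h = g \<otimes> (inv g \<otimes> h)" using gG hG by (simp flip: m_assoc)
      ultimately show "h \<in> (\<lambda>c. g \<otimes> c) ` torus u" by blast
    qed
  qed
  from bij_betw_same_card[OF this] have "card (torus_normalizer u - torus u) = card (torus u)"
    by simp
  moreover have "torus u \<subseteq> torus_normalizer u" using torus_subset_normalizer u by simp
  ultimately show ?thesis
    using card_Diff_subset[OF finite_torus, of u "torus_normalizer u"]
      card_mono[OF finite_torus_normalizer, of "torus u" u] by simp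
qed

lemma card_torus_normalizer:
  assumes u: "u \<in> carrier G - Z"
  shows "card (torus_normalizer u) = card (torus u) \<or> card (torus_normalizer u) = 2 * card (torus u)"
proof (cases "torus_normalizer u = torus u")
  case False
  then obtain g where "g \<in> torus_normalizer u - torus u"
    using torus_subset_normalizer[of u] u by blast
  from card_torus_normalizer_double[OF u this] show ?thesis ..
qed simp

definition density where "density u = real (card (torus_class u)) / real (order G)"

lemma order_pos: "0 < order G"
  using fin by (simp add: order_gt_0_iff_finite)

lemma density_eq:
  assumes u: "u \<in> carrier G - Z"
  shows "density u = (real (card (torus u)) - 2) / real (card (torus_normalizer u))"
proof -
  have c: "4 \<le> card (torus u)" using card_torus[OF u] by auto
  then have "card (torus_normalizer u) > 0" using card_torus_normalizer[OF u] by auto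
  moreover have "real (card (torus_normalizer u)) * real (card (torus_class u))
      = real (order G) * (real (card (torus u)) - 2)"
    using arg_cong[OF card_torus_class[OF u], of real] c by (simp add: of_nat_diff)
  ultimately show ?thesis using order_pos by (simp add: density_def field_simps)
qed

text \<open>
  With \<open>c\<close> the size of the torus, the density is \<open>1 - 2 / c\<close> or \<open>1 / 2 - 1 / c\<close>, according to the
  index of the torus in its normaliser, and \<open>c\<close> is \<open>4\<close> or at least \<open>6\<close>.
\<close>

lemma density_values:
  assumes u: "u \<in> carrier G - Z"
  shows "density u = 1 / 4 \<or> 1 / 3 \<le> density u" and "density u \<le> 1 / 2 \<or> 2 / 3 \<le> density u"
proof -
  define c where "c = real (card (torus u))"
  have c: "c = 4 \<or> 6 \<le> c" using card_torus(1)[OF u] unfolding c_def by linarith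
  have d: "density u = (c - 2) / c \<or> density u = (c - 2) / (2 * c)"
    using density_eq[OF u] card_torus_normalizer[OF u]
    unfolding c_def by (metis of_nat_mult of_nat_numeral)
  have c0: "c > 0" using c by auto
  define i where "i = 1 / c"
  have i: "i = 1 / 4 \<or> (0 < i \<and> i \<le> 1 / 6)"
    using c divide_left_mono[of 6 c 1] by (auto simp: i_def)
  have "(c - 2) / c = 1 - 2 * i" "(c - 2) / (2 * c) = 1 / 2 - i"
    using c0 by (simp_all add: i_def field_simps)
  with d have "density u = 1 - 2 * i \<or> density u = 1 / 2 - i" by simp
  with i show "density u = 1 / 4 \<or> 1 / 3 \<le> density u" "density u \<le> 1 / 2 \<or> 2 / 3 \<le> density u"
    by linarith+
qed

text \<open>
  The densities of the classes add up to \<open>1 - 2 / n\<close>, where \<open>n\<close> is the order of the group. The class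
  of \<open>x\<close> contributes \<open>1 / 2 - 1 / c\<close> with \<open>c \<ge> 16\<close>, and \<open>n > 2 c\<close> since the normaliser of its torus is
  proper. The other classes must therefore add up to a number strictly between \<open>1 / 2\<close> and \<open>9 / 16\<close>.
  One class cannot have such a density; two classes have total density \<open>1 / 2\<close> or at least \<open>7 / 12\<close>;
  three have at least \<open>3 / 4\<close>.
\<close>

lemma no_large_torus:
  assumes x: "x \<in> carrier G - Z" and large: "16 \<le> card (torus x)"
    and inverted: "w \<in> torus_normalizer x - torus x"
    and moved: "y \<in> carrier G - torus_normalizer x"
  shows False
proof -
  define n where "n = real (order G)"
  define c where "c = real (card (torus x))"
  have N: "card (torus_normalizer x) = 2 * card (torus x)"
    by (rule card_torus_normalizer_double[OF x inverted])
  have "torus_normalizer x \<subset> carrier G"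
    using moved by (auto simp: torus_normalizer_def)
  then have "2 * card (torus x) < order G"
    using psubset_card_mono[OF fin] by (simp add: order_def flip: N)
  then have cn: "2 * c < n" and c: "16 \<le> c" using large by (auto simp: n_def c_def)
  define rho where "rho E = real (card E) / n" for E :: "'a set"
  have rho_Diff: "rho (E - torus_class u) = rho E - density u"
    if "torus_class u \<subseteq> E" "E \<subseteq> carrier G" for E u
    using that card_mono[of E "torus_class u"] finite_subset[OF _ fin]
    by (simp add: rho_def density_def n_def card_Diff_subset finite_torus_class of_nat_diff
        diff_divide_distrib)
  have disj: "torus_class v \<subseteq> E - torus_class u"
    if "v \<in> E - torus_class u" "u \<in> carrier G - Z" "E \<subseteq> carrier G - Z"
      "\<And>v. v \<in> E \<Longrightarrow> torus_class v \<subseteq> E" for E u v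
    using that torus_class_sym torus_class_trans by blast
  define E where "E = carrier G - Z"
  have E: "torus_class v \<subseteq> E" if "v \<in> E" for v
    using that torus_class_subset by (auto simp: E_def)
  have rhoE: "rho E = 1 - 2 / n"
    using cn c card_mono[OF fin Z_subset] Z_subset
    by (simp add: rho_def E_def n_def card_Diff_subset[OF finite_subset[OF Z_subset fin]] card_Z
        order_def of_nat_diff diff_divide_distrib)
  have "density x = (c - 2) / (2 * c)"
    using density_eq[OF x] N by (simp add: c_def)
  also have "\<dots> = 1 / 2 - 1 / c"
    using c by (simp add: diff_divide_distrib)
  finally have "density x = 1 / 2 - 1 / c" .
  moreover
  define E1 where "E1 = E - torus_class x"
  have sat1: "E1 \<subseteq> carrier G - Z" "\<And>v. v \<in> E1 \<Longrightarrow> torus_class v \<subseteq> E1"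
    using E disj[of _ E x] x by (auto simp: E1_def E_def)
  moreover have "rho E1 = rho E - density x"
    unfolding E1_def using E x by (intro rho_Diff) (auto simp: E_def)
  moreover have "1 / c > 2 / n" using cn c by (simp add: field_simps)
  moreover have "1 / c \<le> 1 / 16" using c by (simp add: field_simps)
  moreover have "2 / n > 0" using cn c by simp
  ultimately have rho1: "1 / 2 < rho E1" "rho E1 < 9 / 16" using rhoE by linarith+
  have nonempty: "\<exists>v. v \<in> E" if "rho E > 0" for E
    using that by (cases "E = {}") (auto simp: rho_def)
  obtain u where u: "u \<in> E1" using nonempty rho1 by force
  then have uZ: "u \<in> carrier G - Z" using sat1 by blast
  define E2 where "E2 = E1 - torus_class u"
  have sat2: "E2 \<subseteq> carrier G - Z" "\<And>v. v \<in> E2 \<Longrightarrow> torus_class v \<subseteq> E2"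
    using sat1 disj[of _ E1 u] uZ by (auto simp: E2_def)
  have rho2: "rho E2 = rho E1 - density u"
    unfolding E2_def using sat1 u by (intro rho_Diff) auto
  have ge0: "rho E \<ge> 0" for E by (simp add: rho_def n_def)
  have "density u \<le> 1 / 2" using density_values(2)[OF uZ] ge0[of E2] rho1 rho2 by linarith
  then obtain v where v: "v \<in> E2" using nonempty[of E2] rho1 rho2 by force
  then have vZ: "v \<in> carrier G - Z" using sat2 by blast
  define E3 where "E3 = E2 - torus_class v"
  have sat3: "E3 \<subseteq> carrier G - Z" "\<And>v. v \<in> E3 \<Longrightarrow> torus_class v \<subseteq> E3"
    using sat2 disj[of _ E2 v] vZ by (auto simp: E3_def)
  have rho3: "rho E3 = rho E2 - density v"
    unfolding E3_def using sat2 v by (intro rho_Diff) auto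
  have dd: "density u = 1 / 4" "density v = 1 / 4"
    using density_values(1)[OF uZ] density_values(1)[OF vZ] ge0[of E3] rho1 rho2 rho3 by linarith+
  then obtain t where t: "t \<in> E3" using nonempty[of E3] rho1 rho2 rho3 by force
  then have tZ: "t \<in> carrier G - Z" using sat3 by blast
  have "rho (E3 - torus_class t) = rho E3 - density t"
    using sat3 t by (intro rho_Diff) auto
  then show False
    using density_values(1)[OF tZ] ge0[of "E3 - torus_class t"] rho1 rho2 rho3 dd by linarith
qed

end

section \<open>Two by two matrices modulo a prime\<close>

definition mat2 :: "nat \<Rightarrow> int \<Rightarrow> int \<Rightarrow> int \<Rightarrow> int \<Rightarrow> int ^ 2 ^ 2"
  where "mat2 p a b c d = reduce_mod p (vector [vector [a, b], vector [c, d]])"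

lemma mat2_eq_iff:
  "mat2 p a b c d = mat2 p a' b' c' d' \<longleftrightarrow>
    [a = a'] (mod int p) \<and> [b = b'] (mod int p) \<and> [c = c'] (mod int p) \<and> [d = d'] (mod int p)"
  by (auto simp: mat2_def reduce_mod_def vec_eq_iff forall_2 cong_def)

lemma mult_mat2:
  "mat2 p a b c d \<otimes>\<^bsub>SL2 p\<^esub> mat2 p a' b' c' d' =
    mat2 p (a * a' + b * c') (a * b' + b * d') (c * a' + d * c') (c * b' + d * d')"
proof -
  have "(vector [vector [a, b], vector [c, d]] :: int ^ 2 ^ 2) ** vector [vector [a', b'], vector [c', d']] =
      (vector [vector [a * a' + b * c', a * b' + b * d'], vector [c * a' + d * c', c * b' + d * d']] :: int ^ 2 ^ 2)"
    by (simp add: vec_eq_iff forall_2 matrix_matrix_mult_def sum_2)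
  then show ?thesis
    by (simp add: mat2_def SL2_def reduce_mod_mult_left reduce_mod_mult_right)
qed

lemma one_mat2: "\<one>\<^bsub>SL2 p\<^esub> = mat2 p 1 0 0 1"
  by (simp add: mat2_def SL2_def reduce_mod_def vec_eq_iff forall_2 mat_def)

lemma mat2_in_SL2_iff:
  assumes "p > 0"
  shows "mat2 p a b c d \<in> carrier (SL2 p) \<longleftrightarrow> [a * d - b * c = 1] (mod int p)"
proof -
  let ?A = "vector [vector [a, b], vector [c, d]] :: int ^ 2 ^ 2"
  have "mat2 p a b c d \<in> carrier (SL2 p) \<longleftrightarrow> [det ?A = 1] (mod int p)"
    using cong_trans[OF cong_sym[OF cong_det_reduce_mod[of p ?A]], of 1] reduce_mod_in_SL2[OF assms, of ?A]
    by (auto simp: SL2_def mat2_def)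
  then show ?thesis by (simp add: det_2)
qed

lemma SL2_cases:
  assumes "p > 0" and "A \<in> carrier (SL2 p)"
  obtains a b c d where "A = mat2 p a b c d" and "[a * d - b * c = 1] (mod int p)"
proof -
  have "A = mat2 p (A $ 1 $ 1) (A $ 1 $ 2) (A $ 2 $ 1) (A $ 2 $ 2)"
    using reduce_mod_SL2[OF assms(2)] by (simp add: mat2_def reduce_mod_def vec_eq_iff forall_2)
  then show thesis using that assms mat2_in_SL2_iff by metis
qed

lemma finite_SL2: "p > 0 \<Longrightarrow> finite (carrier (SL2 p))"
proof -
  assume p: "p > 0"
  have "A \<in> (\<lambda>(a, b, c, d). mat2 p a b c d) ` ({0..<int p} \<times> {0..<int p} \<times> {0..<int p} \<times> {0..<int p})"
    if A: "A \<in> carrier (SL2 p)" for A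
  proof -
    have "A = mat2 p (A $ 1 $ 1) (A $ 1 $ 2) (A $ 2 $ 1) (A $ 2 $ 2)"
      using reduce_mod_SL2[OF A] by (simp add: mat2_def reduce_mod_def vec_eq_iff forall_2)
    moreover have "A $ i $ j \<in> {0..<int p}" for i j using A by (simp add: SL2_def)
    ultimately show ?thesis by (intro image_eqI[where x = "(A $ 1 $ 1, A $ 1 $ 2, A $ 2 $ 1, A $ 2 $ 2)"]) auto
  qed
  then show ?thesis by (rule finite_subset[OF subsetI]) auto
qed

lemma inv_mat2:
  assumes p: "p > 0" and d: "[a * d - b * c = 1] (mod int p)"
  shows "inv\<^bsub>SL2 p\<^esub> (mat2 p a b c d) = mat2 p d (- b) (- c) a"
proof -
  interpret group "SL2 p" using p by (rule group_SL2)
  show ?thesis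
  proof (rule inv_equality)
    show "mat2 p d (- b) (- c) a \<otimes>\<^bsub>SL2 p\<^esub> mat2 p a b c d = \<one>\<^bsub>SL2 p\<^esub>"
      using d unfolding mult_mat2 one_mat2 mat2_eq_iff cong_iff_dvd_diff
      by (simp add: algebra_simps)
    show "mat2 p d (- b) (- c) a \<in> carrier (SL2 p)" "mat2 p a b c d \<in> carrier (SL2 p)"
      using d by (simp_all add: mat2_in_SL2_iff p algebra_simps)
  qed
qed

text \<open>
  Two matrices commute if and only if their traceless parts are proportional, that is, if and only if the
  vectors \<open>(b, c, a - d)\<close> and \<open>(f, g, e - h)\<close> are.
\<close>

lemma commute_mat2_iff:
  "mat2 p a b c d \<otimes>\<^bsub>SL2 p\<^esub> mat2 p e f g h = mat2 p e f g h \<otimes>\<^bsub>SL2 p\<^esub> mat2 p a b c d \<longleftrightarrow>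
    [b * g = c * f] (mod int p) \<and> [b * (e - h) = f * (a - d)] (mod int p) \<and>
    [c * (e - h) = g * (a - d)] (mod int p)" (is "?l \<longleftrightarrow> ?r")
proof
  assume ?l then show ?r
    unfolding mult_mat2 mat2_eq_iff cong_iff_dvd_diff by (intro conjI; Groebner_Basis.algebra)
next
  assume ?r then show ?l
    unfolding mult_mat2 mat2_eq_iff cong_iff_dvd_diff by (intro conjI; Groebner_Basis.algebra)
qed

locale SL2_mod_prime =
  fixes p :: nat
  assumes prime_p: "Factorial_Ring.prime p" and p_gt_2: "p > 2"
begin

lemma p_pos: "p > 0" using p_gt_2 by simp

sublocale SL2: group "SL2 p" by (rule group_SL2[OF p_pos])

lemma dvd_mult_iff: "int p dvd a * b \<longleftrightarrow> int p dvd a \<or> int p dvd b"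
  using prime_p by (simp add: prime_dvd_mult_iff)

lemma not_dvd_2: "\<not> int p dvd 2"
  using p_gt_2 zdvd_imp_le by force

lemma cong_mult_cancel: "[k * a = k * b] (mod int p) \<Longrightarrow> \<not> int p dvd k \<Longrightarrow> [a = b] (mod int p)"
  by (simp add: cong_iff_dvd_diff dvd_mult_iff flip: right_diff_distrib)

definition centre :: "(int ^ 2 ^ 2) set"
  where "centre = {mat2 p 1 0 0 1, mat2 p (- 1) 0 0 (- 1)}"

lemma scalar_in_centre:
  assumes det: "[a * d - b * c = 1] (mod int p)"
    and "[b = 0] (mod int p)" "[c = 0] (mod int p)" "[a = d] (mod int p)"
  shows "mat2 p a b c d \<in> centre"
proof -
  have "int p dvd (a - 1) * (a + 1)"
    using assms unfolding cong_iff_dvd_diff by Groebner_Basis.algebra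
  then have "int p dvd a - 1 \<or> int p dvd a + 1" by (simp add: dvd_mult_iff)
  then show ?thesis
  proof
    assume "int p dvd a - 1"
    moreover from this have "int p dvd d - 1"
      using assms(4) unfolding cong_iff_dvd_diff by Groebner_Basis.algebra
    ultimately have "mat2 p a b c d = mat2 p 1 0 0 1"
      using assms(2,3) by (simp add: mat2_eq_iff cong_iff_dvd_diff)
    then show ?thesis by (simp add: centre_def)
  next
    assume "int p dvd a + 1"
    moreover from this have "int p dvd d + 1"
      using assms(4) unfolding cong_iff_dvd_diff by Groebner_Basis.algebra
    ultimately have "mat2 p a b c d = mat2 p (- 1) 0 0 (- 1)"
      using assms(2,3) by (simp add: mat2_eq_iff cong_iff_dvd_diff)
    then show ?thesis by (simp add: centre_def)
  qed
qed

lemma card_centre: "card centre = 2"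
proof -
  have "mat2 p 1 0 0 1 \<noteq> mat2 p (- 1) 0 0 (- 1)"
    using not_dvd_2 by (simp add: mat2_eq_iff cong_iff_dvd_diff)
  then show ?thesis by (simp add: centre_def)
qed

lemma centre_commute:
  assumes "z \<in> centre" "g \<in> carrier (SL2 p)"
  shows "z \<otimes>\<^bsub>SL2 p\<^esub> g = g \<otimes>\<^bsub>SL2 p\<^esub> z"
proof -
  obtain a b c d where "g = mat2 p a b c d" using SL2_cases[OF p_pos assms(2)] by metis
  then show ?thesis using assms(1) by (auto simp: centre_def mult_mat2)
qed

lemma subgroup_centre: "subgroup centre (SL2 p)"
proof (rule SL2.subgroupI)
  show "centre \<subseteq> carrier (SL2 p)" by (auto simp: centre_def mat2_in_SL2_iff p_pos)
  show "inv\<^bsub>SL2 p\<^esub> a \<in> centre" if "a \<in> centre" for a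
    using that by (auto simp: centre_def inv_mat2 p_pos)
  show "a \<otimes>\<^bsub>SL2 p\<^esub> b \<in> centre" if "a \<in> centre" "b \<in> centre" for a b
    using that by (auto simp: centre_def mult_mat2)
qed (auto simp: centre_def)

text \<open>
  The expression is the discriminant \<open>(a + d)\<^sup>2 - 4 (a d - b c)\<close> of the characteristic polynomial, so
  the condition says that the eigenvalues are distinct.
\<close>

definition regular_semisimple :: "int ^ 2 ^ 2 \<Rightarrow> bool"
  where "regular_semisimple u \<longleftrightarrow>
    (\<exists>a b c d. u = mat2 p a b c d \<and> \<not> int p dvd (a - d) ^ 2 + 4 * b * c)"

text \<open>
  If the traceless parts of \<open>v\<close> and \<open>w\<close> are both proportional to that of \<open>u\<close>, then the discriminant of
  \<open>u\<close> times each of the expressions that measure the proportionality of \<open>v\<close> and \<open>w\<close> vanishes.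
\<close>

lemma centralizer_commutative:
  assumes "regular_semisimple u" "v \<in> carrier (SL2 p)" "w \<in> carrier (SL2 p)"
    and uv: "u \<otimes>\<^bsub>SL2 p\<^esub> v = v \<otimes>\<^bsub>SL2 p\<^esub> u" and uw: "u \<otimes>\<^bsub>SL2 p\<^esub> w = w \<otimes>\<^bsub>SL2 p\<^esub> u"
  shows "v \<otimes>\<^bsub>SL2 p\<^esub> w = w \<otimes>\<^bsub>SL2 p\<^esub> v"
proof -
  obtain a b c d where u: "u = mat2 p a b c d" and D: "\<not> int p dvd (a - d) ^ 2 + 4 * b * c"
    using assms(1) by (auto simp: regular_semisimple_def)
  obtain e f g h where v: "v = mat2 p e f g h" using SL2_cases[OF p_pos assms(2)] by metis
  obtain i j k l where w: "w = mat2 p i j k l" using SL2_cases[OF p_pos assms(3)] by metis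
  note hyps = uv[unfolded u v commute_mat2_iff cong_iff_dvd_diff]
    uw[unfolded u w commute_mat2_iff cong_iff_dvd_diff]
  have "int p dvd ((a - d) ^ 2 + 4 * b * c) * (f * k - g * j)"
    using hyps by Groebner_Basis.algebra
  moreover have "int p dvd ((a - d) ^ 2 + 4 * b * c) * (f * (i - l) - j * (e - h))"
    using hyps by Groebner_Basis.algebra
  moreover have "int p dvd ((a - d) ^ 2 + 4 * b * c) * (g * (i - l) - k * (e - h))"
    using hyps by Groebner_Basis.algebra
  ultimately show ?thesis
    using D unfolding v w commute_mat2_iff cong_iff_dvd_diff dvd_mult_iff by blast
qed

text \<open>
  As a conjugate of \<open>u\<close>, the matrix \<open>v\<close> has the same trace and hence the same discriminant. Its
  traceless part is a multiple of that of \<open>u\<close> with the same value of the discriminant form, so the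
  factor is \<open>1\<close> or \<open>- 1\<close>. These two cases are \<open>v = u\<close> and \<open>v = u\<^sup>-\<^sup>1\<close>.
\<close>

lemma conjugate_in_torus:
  assumes "regular_semisimple u" "u \<in> carrier (SL2 p)" "g \<in> carrier (SL2 p)" "v \<in> carrier (SL2 p)"
    and conj: "g \<otimes>\<^bsub>SL2 p\<^esub> u = v \<otimes>\<^bsub>SL2 p\<^esub> g"
    and comm: "u \<otimes>\<^bsub>SL2 p\<^esub> v = v \<otimes>\<^bsub>SL2 p\<^esub> u"
  shows "v = u \<or> u \<otimes>\<^bsub>SL2 p\<^esub> v = \<one>\<^bsub>SL2 p\<^esub>"
proof -
  obtain a b c d where u: "u = mat2 p a b c d" and D: "\<not> int p dvd (a - d) ^ 2 + 4 * b * c"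
    using assms(1) by (auto simp: regular_semisimple_def)
  obtain e f g' h where v: "v = mat2 p e f g' h" and dv: "[e * h - f * g' = 1] (mod int p)"
    using SL2_cases[OF p_pos assms(4)] by metis
  obtain k l m n where g: "g = mat2 p k l m n" and dg: "[k * n - l * m = 1] (mod int p)"
    using SL2_cases[OF p_pos assms(3)] by metis
  have du: "[a * d - b * c = 1] (mod int p)" using assms(2) by (simp add: u mat2_in_SL2_iff p_pos)
  have tr: "int p dvd (e + h) - (a + d)"
    using conj dg unfolding u v g mult_mat2 mat2_eq_iff cong_iff_dvd_diff by Groebner_Basis.algebra
  note par = comm[unfolded u v commute_mat2_iff cong_iff_dvd_diff]
  define disc where "disc = (a - d) ^ 2 + 4 * b * c"
  \<comment> \<open>the polar form of the discriminant, evaluated at \<open>u\<close> and \<open>v\<close>\<close>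
  define pol where "pol = (a - d) * (e - h) + 2 * (b * g' + c * f)"
  have disc_v: "int p dvd (e - h) ^ 2 + 4 * f * g' - disc"
    using tr du dv unfolding disc_def cong_iff_dvd_diff by Groebner_Basis.algebra
  have "int p dvd pol ^ 2 - disc * ((e - h) ^ 2 + 4 * f * g')"
    using par unfolding disc_def pol_def by Groebner_Basis.algebra
  then have "int p dvd (pol - disc) * (pol + disc)"
    using disc_v by Groebner_Basis.algebra
  then have cases: "int p dvd pol - disc \<or> int p dvd pol + disc"
    by (simp add: dvd_mult_iff)
  have scaled: "int p dvd disc * f - pol * b" "int p dvd disc * g' - pol * c"
    "int p dvd disc * (e - h) - pol * (a - d)"
    using par unfolding disc_def pol_def by Groebner_Basis.algebra+
  have D': "\<not> int p dvd disc" using D by (simp add: disc_def)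
  from cases show ?thesis
  proof
    assume s: "int p dvd pol - disc"
    have "int p dvd disc * (f - b)" "int p dvd disc * (g' - c)" "int p dvd disc * ((e - h) - (a - d))"
      using scaled s by Groebner_Basis.algebra+
    then have fg: "int p dvd f - b" "int p dvd g' - c" "int p dvd (e - h) - (a - d)"
      using D' by (simp_all add: dvd_mult_iff)
    have "int p dvd 2 * (e - a)" "int p dvd 2 * (h - d)"
      using fg(3) tr by Groebner_Basis.algebra+
    then have "int p dvd e - a" "int p dvd h - d" using not_dvd_2 by (simp_all only: dvd_mult_iff simp_thms)
    with fg have "v = u" unfolding u v mat2_eq_iff cong_iff_dvd_diff by simp
    then show ?thesis ..
  next
    assume s: "int p dvd pol + disc"
    have "int p dvd disc * (f + b)" "int p dvd disc * (g' + c)" "int p dvd disc * ((e - h) + (a - d))"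
      using scaled s by Groebner_Basis.algebra+
    then have fg: "int p dvd f + b" "int p dvd g' + c" "int p dvd (e - h) + (a - d)"
      using D' by (simp_all add: dvd_mult_iff)
    have "int p dvd 2 * (e - d)" "int p dvd 2 * (h - a)"
      using fg(3) tr by Groebner_Basis.algebra+
    then have "int p dvd e - d" "int p dvd h - a" using not_dvd_2 by (simp_all only: dvd_mult_iff simp_thms)
    with fg du have "u \<otimes>\<^bsub>SL2 p\<^esub> v = \<one>\<^bsub>SL2 p\<^esub>"
      unfolding u v mult_mat2 one_mat2 mat2_eq_iff cong_iff_dvd_diff by (intro conjI; Groebner_Basis.algebra)
    then show ?thesis ..
  qed
qed

end

section \<open>Transvections generate\<close>

context SL2_mod_prime begin

lemma obtain_mod_inverse:
  assumes "\<not> int p dvd s"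
  obtains s' where "[s * s' = 1] (mod int p)"
proof -
  have "coprime (int p) s" using assms prime_p by (simp add: prime_imp_coprime)
  then have "coprime s (int p)" by (simp add: coprime_commute)
  from cong_solve_coprime_int[OF this] that show thesis by blast
qed

text \<open>
  For the column vector \<open>v = (x, y)\<close> and the alternating matrix \<open>J\<close> with rows \<open>(0, - 1)\<close> and \<open>(1, 0)\<close>,
  this is \<open>1 + s v v\<^sup>T J\<close>; it fixes \<open>v\<close>. Every matrix \<open>g\<close> of determinant one satisfies
  \<open>g\<^sup>T J g = J\<close>, so conjugation by \<open>g\<close> replaces \<open>v\<close> by \<open>g v\<close> and keeps \<open>s\<close>.
\<close>

definition transvection :: "int \<Rightarrow> int \<Rightarrow> int \<Rightarrow> int ^ 2 ^ 2"
  where "transvection x y s = mat2 p (1 + s * x * y) (- (s * x * x)) (s * y * y) (1 - s * x * y)"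

definition transvection_direction :: "(int ^ 2 ^ 2) set \<Rightarrow> int \<Rightarrow> int \<Rightarrow> bool"
  where "transvection_direction B x y \<longleftrightarrow> (\<forall>s. transvection x y s \<in> B)"

lemma transvection_cong:
  assumes "[x = x'] (mod int p)" "[y = y'] (mod int p)" "[s = s'] (mod int p)"
  shows "transvection x y s = transvection x' y' s'"
  using assms unfolding transvection_def mat2_eq_iff
  by (intro conjI cong_add cong_mult cong_diff cong_refl cong_minus_minus_iff[THEN iffD2])

lemma transvection_add:
  "transvection x y s \<otimes>\<^bsub>SL2 p\<^esub> transvection x y t = transvection x y (s + t)"
  by (simp add: transvection_def mult_mat2 algebra_simps)

lemma transvection_in_SL2: "transvection x y s \<in> carrier (SL2 p)"
  unfolding transvection_def mat2_in_SL2_iff[OF p_pos] by (simp add: algebra_simps)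

lemma transvection_multiple:
  assumes B: "subgroup B (SL2 p)" and "transvection x y s \<in> B"
  shows "transvection x y (int k * s) \<in> B"
proof (induction k)
  case 0
  then show ?case
    using subgroup.one_closed[OF B] by (simp add: transvection_def one_mat2)
next
  case (Suc k)
  from subgroup.m_closed[OF B assms(2) this] show ?case
    by (simp add: transvection_add algebra_simps)
qed

text \<open>
  The nonzero element \<open>s\<close> generates the additive group of the prime field.
\<close>

lemma transvection_directionI:
  assumes B: "subgroup B (SL2 p)" and "transvection x y s \<in> B" and s: "\<not> int p dvd s"
  shows "transvection_direction B x y"
  unfolding transvection_direction_def
proof
  fix t
  obtain s' where s': "[s * s' = 1] (mod int p)" using obtain_mod_inverse[OF s] .
  define k where "k = nat ((t * s') mod int p)"
  have "[int k = t * s'] (mod int p)" using p_pos by (simp add: k_def)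
  with s' have "[int k * s = t] (mod int p)"
    unfolding cong_iff_dvd_diff by Groebner_Basis.algebra
  from transvection_cong[OF cong_refl cong_refl this] show "transvection x y t \<in> B"
    using transvection_multiple[OF B assms(2), of k] by metis
qed

lemma transvection_direction_cong:
  assumes "transvection_direction B x y" "[x = x'] (mod int p)" "[y = y'] (mod int p)"
  shows "transvection_direction B x' y'"
  using assms transvection_cong[OF assms(2,3) cong_refl] by (metis transvection_direction_def)

lemma transvection_direction_scale:
  assumes "transvection_direction B x y"
  shows "transvection_direction B (k * x) (k * y)"
proof -
  have "transvection (k * x) (k * y) s = transvection x y (k * k * s)" for s
    by (simp add: transvection_def mult_ac)
  with assms show ?thesis by (simp add: transvection_direction_def)
qed

lemma transvection_direction_unscale:
  assumes "transvection_direction B (k * x) (k * y)" and "\<not> int p dvd k"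
  shows "transvection_direction B x y"
proof -
  obtain k' where k': "[k * k' = 1] (mod int p)" using obtain_mod_inverse[OF assms(2)] .
  show ?thesis
  proof (rule transvection_direction_cong[OF transvection_direction_scale[OF assms(1), of k']])
    show "[k' * (k * x) = x] (mod int p)" "[k' * (k * y) = y] (mod int p)"
      using k' unfolding cong_iff_dvd_diff by Groebner_Basis.algebra+
  qed
qed

lemma transvection_direction_apply:
  assumes B: "subgroup B (SL2 p)" and g: "mat2 p a b c d \<in> B"
    and dir: "transvection_direction B x y"
  shows "transvection_direction B (a * x + b * y) (c * x + d * y)"
  unfolding transvection_direction_def
proof
  fix s
  have gS: "mat2 p a b c d \<in> carrier (SL2 p)" using subgroup.mem_carrier[OF B g] .
  then have det: "[a * d - b * c = 1] (mod int p)" by (simp add: mat2_in_SL2_iff p_pos)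
  have "mat2 p a b c d \<otimes>\<^bsub>SL2 p\<^esub> transvection x y s =
      transvection (a * x + b * y) (c * x + d * y) s \<otimes>\<^bsub>SL2 p\<^esub> mat2 p a b c d"
    using det unfolding transvection_def mult_mat2 mat2_eq_iff cong_iff_dvd_diff
    by (intro conjI; Groebner_Basis.algebra)
  then have "transvection (a * x + b * y) (c * x + d * y) s =
      mat2 p a b c d \<otimes>\<^bsub>SL2 p\<^esub> transvection x y s \<otimes>\<^bsub>SL2 p\<^esub> inv\<^bsub>SL2 p\<^esub> (mat2 p a b c d)"
    using gS transvection_in_SL2 SL2.inv_solve_right by (metis SL2.m_closed)
  then show "transvection (a * x + b * y) (c * x + d * y) s \<in> B"
    using B g dir by (simp add: transvection_direction_def subgroup.m_closed subgroup.m_inv_closed)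
qed

text \<open>
  The transvections along \<open>(x, y)\<close> move \<open>(x', y')\<close> to its sum with any multiple of \<open>(x, y)\<close>, and up to
  scaling every vector is such a sum or a multiple of \<open>(x, y)\<close>. The target \<open>(\<alpha>, \<beta>)\<close> is first multiplied
  by the determinant of the two directions; by Cramer's rule, its coefficients are then polynomials
  and need no inverses.
\<close>

lemma independent_directions_imp_all_directions:
  assumes B: "subgroup B (SL2 p)"
    and dir: "transvection_direction B x y" "transvection_direction B x' y'"
    and indep: "\<not> int p dvd x * y' - y * x'"
  shows "transvection_direction B \<alpha> \<beta>"
proof (rule transvection_direction_unscale[OF _ indep])
  define \<omega> m n where "\<omega> = x * y' - y * x'" and "m = x * \<beta> - y * \<alpha>" and "n = \<alpha> * y' - \<beta> * x'"
  have expand: "\<omega> * \<alpha> = m * x' + n * x" "\<omega> * \<beta> = m * y' + n * y"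
    by (simp_all add: \<omega>_def m_def n_def algebra_simps)
  have "transvection_direction B (m * x' + n * x) (m * y' + n * y)"
  proof (cases "int p dvd m")
    case True
    then have "[n * x = m * x' + n * x] (mod int p)" "[n * y = m * y' + n * y] (mod int p)"
      by (simp_all add: cong_iff_dvd_diff)
    from transvection_direction_cong[OF transvection_direction_scale[OF dir(1)] this]
    show ?thesis .
  next
    case False
    then have "\<not> int p dvd - (m * \<omega>)" using indep by (simp add: \<omega>_def dvd_mult_iff)
    then obtain k where k: "[- (m * \<omega>) * k = 1] (mod int p)" using obtain_mod_inverse by blast
    define s where "s = k * n"
    have "mat2 p (1 + s * x * y) (- (s * x * x)) (s * y * y) (1 - s * x * y) \<in> B"
      using dir(1) by (simp add: transvection_direction_def transvection_def)
    from transvection_direction_apply[OF B this transvection_direction_scale[OF dir(2), of m]]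
    show ?thesis
    proof (rule transvection_direction_cong)
      show "[(1 + s * x * y) * (m * x') + - (s * x * x) * (m * y') = m * x' + n * x] (mod int p)"
        "[s * y * y * (m * x') + (1 - s * x * y) * (m * y') = m * y' + n * y] (mod int p)"
        using k unfolding cong_iff_dvd_diff s_def \<omega>_def by Groebner_Basis.algebra+
    qed
  qed
  then show "transvection_direction B ((x * y' - y * x') * \<alpha>) ((x * y' - y * x') * \<beta>)"
    using expand by (simp add: \<omega>_def)
qed

text \<open>
  A matrix whose lower left entry \<open>c\<close> is invertible is an upper, a lower and an upper elementary
  matrix multiplied together; adding the first row to the second reduces the other matrices to this case.
\<close>

lemma all_directions_imp_SL2:
  assumes B: "subgroup B (SL2 p)" and dir: "\<And>x y. transvection_direction B x y"
  shows "B = carrier (SL2 p)"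
proof
  show "B \<subseteq> carrier (SL2 p)" using B by (rule subgroup.subset)
  have U: "mat2 p 1 s 0 1 \<in> B" for s
    using dir[of 1 0] by (auto simp: transvection_direction_def transvection_def dest: spec[of _ "- s"])
  have L: "mat2 p 1 0 s 1 \<in> B" for s
    using dir[of 0 1] by (auto simp: transvection_direction_def transvection_def dest: spec[of _ s])
  have big: "mat2 p a b c d \<in> B"
    if c: "\<not> int p dvd c" and det: "[a * d - b * c = 1] (mod int p)" for a b c d
  proof -
    obtain c' where c': "[c * c' = 1] (mod int p)" using obtain_mod_inverse[OF c] .
    have "mat2 p a b c d =
        mat2 p 1 ((a - 1) * c') 0 1 \<otimes>\<^bsub>SL2 p\<^esub> mat2 p 1 0 c 1 \<otimes>\<^bsub>SL2 p\<^esub> mat2 p 1 ((d - 1) * c') 0 1"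
      using det c' unfolding mult_mat2 mat2_eq_iff cong_iff_dvd_diff
      by (intro conjI; (Groebner_Basis.algebra | simp))
    then show ?thesis using U L B by (simp add: subgroup.m_closed)
  qed
  show "carrier (SL2 p) \<subseteq> B"
  proof
    fix A assume "A \<in> carrier (SL2 p)"
    then obtain a b c d where A: "A = mat2 p a b c d" and det: "[a * d - b * c = 1] (mod int p)"
      using SL2_cases[OF p_pos] by metis
    show "A \<in> B"
    proof (cases "int p dvd c")
      case False
      then show ?thesis using big det A by simp
    next
      case True
      have "\<not> int p dvd a"
      proof
        assume "int p dvd a"
        with True det have "int p dvd 1" unfolding cong_iff_dvd_diff by Groebner_Basis.algebra
        then show False using p_gt_2 by simp
      qed
      then have "\<not> int p dvd c + a" using True dvd_add_right_iff by blast
      moreover have "[a * (d + b) - b * (c + a) = 1] (mod int p)"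
        using det by (simp add: algebra_simps)
      ultimately have "mat2 p a b (c + a) (d + b) \<in> B" by (rule big)
      from subgroup.m_closed[OF B L[of "- 1"] this] show ?thesis
        by (simp add: A mult_mat2)
    qed
  qed
qed

text \<open>
  The matrix minus one is nilpotent of rank one, so its image is its kernel; any nonzero column spans
  the fixed line.
\<close>

lemma unipotent_is_transvection:
  assumes det: "[a * d - b * c = 1] (mod int p)" and tr: "[a + d = 2] (mod int p)"
    and "mat2 p a b c d \<notin> centre"
  obtains x y s where "mat2 p a b c d = transvection x y s" "\<not> int p dvd s"
    "\<not> (int p dvd x \<and> int p dvd y)"
proof (cases "int p dvd b")
  case False
  obtain b' where b': "[b * b' = 1] (mod int p)" using obtain_mod_inverse[OF False] .
  have "\<not> int p dvd - b'"
  proof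
    assume "int p dvd - b'"
    with b' have "int p dvd 1" unfolding cong_iff_dvd_diff by Groebner_Basis.algebra
    then show False using p_gt_2 by simp
  qed
  moreover have "mat2 p a b c d = transvection b (1 - a) (- b')"
    using det tr b' unfolding transvection_def mat2_eq_iff cong_iff_dvd_diff
    by (intro conjI; Groebner_Basis.algebra)
  ultimately show thesis using that False by blast
next
  case True
  then have "int p dvd (a - 1) * (a - 1)"
    using det tr unfolding cong_iff_dvd_diff by Groebner_Basis.algebra
  then have a: "int p dvd a - 1" by (simp add: dvd_mult_iff)
  then have d: "int p dvd d - 1" using tr unfolding cong_iff_dvd_diff by Groebner_Basis.algebra
  have "int p dvd a - d" using a d by Groebner_Basis.algebra
  then have "\<not> int p dvd c"
    using assms(3) scalar_in_centre[OF det] True by (auto simp: cong_iff_dvd_diff)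
  moreover have "mat2 p a b c d = transvection 0 1 c"
    using True a d by (simp add: transvection_def mat2_eq_iff cong_iff_dvd_diff)
  moreover have "\<not> int p dvd 1" using p_gt_2 by simp
  ultimately show thesis using that by blast
qed

text \<open>
  Up to sign, \<open>u\<close> is a transvection. A second direction is found by applying the diagonal matrix if
  the fixed line is not a coordinate axis, and the antidiagonal one otherwise.
\<close>

lemma subgroup_with_unipotent_is_SL2:
  assumes B: "subgroup B (SL2 p)"
    and diag: "mat2 p z 0 0 z' \<in> B" "\<not> int p dvd z' - z"
    and antidiag: "mat2 p 0 1 (- 1) 0 \<in> B"
    and u: "u \<in> B" "u \<notin> centre" "\<not> regular_semisimple u"
  shows "B = carrier (SL2 p)"
proof -
  obtain a b c d where abcd: "u = mat2 p a b c d" and det: "[a * d - b * c = 1] (mod int p)"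
    using SL2_cases[OF p_pos] subgroup.mem_carrier[OF B u(1)] by metis
  have "int p dvd (a - d)\<^sup>2 + 4 * b * c" using u(3) abcd by (auto simp: regular_semisimple_def)
  then have "int p dvd (a + d - 2) * (a + d + 2)"
    using det unfolding cong_iff_dvd_diff by Groebner_Basis.algebra
  then have tr: "int p dvd a + d - 2 \<or> int p dvd a + d + 2" by (simp add: dvd_mult_iff)
  have neg: "mat2 p (- e) (- f) (- g) (- h) \<in> B" if "mat2 p e f g h \<in> B" for e f g h
    using subgroup.m_closed[OF B that subgroup.m_closed[OF B antidiag antidiag]]
    by (simp add: mult_mat2)
  have "\<exists>x y s. transvection x y s \<in> B \<and> \<not> int p dvd s \<and> \<not> (int p dvd x \<and> int p dvd y)"
    using tr
  proof
    assume "int p dvd a + d - 2"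
    then have "[a + d = 2] (mod int p)" by (simp add: cong_iff_dvd_diff)
    from unipotent_is_transvection[OF det this] show ?thesis using u abcd by metis
  next
    assume "int p dvd a + d + 2"
    then have tr': "[- a + - d = 2] (mod int p)"
      using dvd_minus_iff[of "int p" "a + d + 2"] by (simp add: cong_iff_dvd_diff algebra_simps)
    have det': "[- a * - d - - b * - c = 1] (mod int p)" using det by simp
    have "mat2 p (- a) (- b) (- c) (- d) \<notin> centre"
    proof
      assume "mat2 p (- a) (- b) (- c) (- d) \<in> centre"
      moreover have "mat2 p (- 1) 0 0 (- 1) \<in> centre" by (simp add: centre_def)
      ultimately have "mat2 p (- a) (- b) (- c) (- d) \<otimes>\<^bsub>SL2 p\<^esub> mat2 p (- 1) 0 0 (- 1) \<in> centre"
        using subgroup_centre by (rule subgroup.m_closed[rotated])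
      then show False using u(2) by (simp add: mult_mat2 abcd)
    qed
    from unipotent_is_transvection[OF det' tr' this] show ?thesis
      using neg u(1) abcd by metis
  qed
  then obtain x y where dir: "transvection_direction B x y" and nz: "\<not> (int p dvd x \<and> int p dvd y)"
    using transvection_directionI[OF B] by blast
  have "transvection_direction B \<alpha> \<beta>" for \<alpha> \<beta>
  proof (cases "int p dvd x * y")
    case False
    have "transvection_direction B (z * x) (z' * y)"
      using transvection_direction_apply[OF B diag(1) dir] by simp
    moreover have "x * (z' * y) - y * (z * x) = x * y * (z' - z)" by (simp add: algebra_simps)
    with False diag(2) have "\<not> int p dvd x * (z' * y) - y * (z * x)" by (simp add: dvd_mult_iff)
    ultimately show ?thesis
      using independent_directions_imp_all_directions[OF B dir] by blast
  next
    case True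
    have "transvection_direction B y (- x)"
      using transvection_direction_apply[OF B antidiag dir] by simp
    moreover have "\<not> int p dvd x * - x - y * y"
    proof
      assume *: "int p dvd x * - x - y * y"
      have "int p dvd x * x * (x * x)" "int p dvd y * y * (y * y)"
        using * True by Groebner_Basis.algebra+
      then show False using nz by (simp add: dvd_mult_iff)
    qed
    ultimately show ?thesis
      using independent_directions_imp_all_directions[OF B dir] by blast
  qed
  then show ?thesis by (rule all_directions_imp_SL2[OF B])
qed

end

section \<open>Monomial and full matrices over the sixteenth roots of unity\<close>

text \<open>
  The congruence for \<open>z\<close> makes it a primitive sixteenth root of unity. Since \<open>z\<^sup>6 = - z\<^sup>-\<^sup>2\<close>, the number
  \<open>2 s\<close> is the square root \<open>z\<^sup>2 + z\<^sup>-\<^sup>2\<close> of two, and \<open>s = 1 / \<surd>2\<close>.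
\<close>

locale binary_octahedral = SL2_mod_prime +
  fixes z s :: int
  assumes z8: "[z ^ 8 = - 1] (mod int p)" and s: "[2 * s = z ^ 2 - z ^ 6] (mod int p)"
begin

text \<open>Reducing the exponent modulo 16 gives negative powers without inverses modulo \<open>p\<close>.\<close>

definition \<zeta> :: "int \<Rightarrow> int"
  where "\<zeta> k = z ^ nat (k mod 16)"

lemma \<zeta>_mod: "j mod 16 = k mod 16 \<Longrightarrow> \<zeta> j = \<zeta> k"
  by (simp add: \<zeta>_def)

lemma \<zeta>_shift: "j = k + 16 * t \<Longrightarrow> \<zeta> j = \<zeta> k"
  by (rule \<zeta>_mod) simp

lemma \<zeta>_0 [simp]: "\<zeta> 0 = 1"
  by (simp add: \<zeta>_def)

lemma \<zeta>_add: "[\<zeta> (j + k) = \<zeta> j * \<zeta> k] (mod int p)"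
proof -
  have z16: "[z ^ 16 = 1] (mod int p)"
    using cong_mult[OF z8 z8] by (simp flip: power_add)
  define m n where "m = nat (j mod 16)" and "n = nat (k mod 16)"
  have "nat ((j + k) mod 16) = (m + n) mod 16"
  proof -
    have "(j + k) mod 16 = int ((m + n) mod 16)"
      by (simp add: m_def n_def zmod_int mod_add_eq)
    then show ?thesis by simp
  qed
  moreover have "[z ^ ((m + n) mod 16) = z ^ (m + n)] (mod int p)"
  proof -
    have "z ^ (m + n) = (z ^ 16) ^ ((m + n) div 16) * z ^ ((m + n) mod 16)"
      by (simp flip: power_mult power_add)
    moreover have "[(z ^ 16) ^ ((m + n) div 16) * z ^ ((m + n) mod 16) = 1 ^ ((m + n) div 16) * z ^ ((m + n) mod 16)] (mod int p)"
      by (intro cong_mult cong_pow z16 cong_refl)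
    ultimately show ?thesis by (simp add: cong_sym)
  qed
  ultimately have "[z ^ nat ((j + k) mod 16) = z ^ m * z ^ n] (mod int p)"
    by (simp only: power_add)
  then show ?thesis unfolding \<zeta>_def m_def n_def .
qed

lemma \<zeta>_8: "[\<zeta> 8 = - 1] (mod int p)"
  using z8 by (simp add: \<zeta>_def)

lemma \<zeta>_diff: "[\<zeta> (j - k) = \<zeta> j * \<zeta> (- k)] (mod int p)"
  using \<zeta>_add[of j "- k"] by simp

lemma \<zeta>_add_8: "[\<zeta> (j + 8) = - \<zeta> j] (mod int p)"
  using \<zeta>_add[of j 8] \<zeta>_8 unfolding cong_iff_dvd_diff by Groebner_Basis.algebra

lemma \<zeta>_inverse: "[\<zeta> k * \<zeta> (- k) = 1] (mod int p)"
  using \<zeta>_add[of k "- k"] by (simp add: cong_sym)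

lemma not_dvd_1: "\<not> int p dvd 1"
  using p_gt_2 by simp

lemma \<zeta>_nonzero: "\<not> int p dvd \<zeta> k"
proof
  assume "int p dvd \<zeta> k"
  with \<zeta>_inverse[of k] have "int p dvd 1" unfolding cong_iff_dvd_diff by Groebner_Basis.algebra
  then show False using not_dvd_1 by simp
qed

text \<open>
  Every nonzero residue modulo 16 has a multiple equal to 8, whereas \<open>z\<^sup>8 = - 1 \<noteq> 1\<close>.
\<close>

lemma \<zeta>_eq_1_imp:
  assumes "[\<zeta> m = 1] (mod int p)"
  shows "m mod 16 = 0"
proof (rule ccontr)
  assume "m mod 16 \<noteq> 0"
  moreover define r where "r = m mod 16"
  ultimately have "r \<in> {1..15}" by (auto simp: int_one_le_iff_zero_less le_less)
  also have "{1..15::int} = {1, 2, 3, 4, 5, 6, 7, 8, 9, 10, 11, 12, 13, 14, 15}"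
    by (rule Set.set_eqI, simp only: atLeastAtMost_iff insert_iff empty_iff, presburger)
  finally have "(int 1 * r) mod 16 = 8 \<or> (int 2 * r) mod 16 = 8 \<or> (int 4 * r) mod 16 = 8 \<or> (int 8 * r) mod 16 = 8"
    by auto
  then obtain k :: nat where "(int k * r) mod 16 = 8" by blast
  then have k: "(int k * m) mod 16 = 8" by (simp add: r_def mod_mult_right_eq)
  have "[\<zeta> (int k * m) = 1] (mod int p)" for k
  proof (induction k)
    case (Suc k)
    have "[\<zeta> (m + int k * m) = 1] (mod int p)"
      using \<zeta>_add[of m "int k * m"] Suc assms unfolding cong_iff_dvd_diff by Groebner_Basis.algebra
    then show ?case by (simp add: algebra_simps)
  qed simp
  from this[of k] have "[\<zeta> 8 = 1] (mod int p)" using \<zeta>_mod[of "int k * m" 8] k by simp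
  with \<zeta>_8 have "int p dvd 2" unfolding cong_iff_dvd_diff by Groebner_Basis.algebra
  then show False using not_dvd_2 by simp
qed

lemma \<zeta>_eq_iff: "[\<zeta> j = \<zeta> k] (mod int p) \<longleftrightarrow> j mod 16 = k mod 16"
proof
  assume "[\<zeta> j = \<zeta> k] (mod int p)"
  with \<zeta>_diff[of j k] \<zeta>_inverse[of k] have "[\<zeta> (j - k) = 1] (mod int p)"
    unfolding cong_iff_dvd_diff by Groebner_Basis.algebra
  then have "(j - k) mod 16 = 0" by (rule \<zeta>_eq_1_imp)
  then show "j mod 16 = k mod 16" by (simp add: mod_eq_dvd_iff mod_eq_0_iff_dvd)
next
  assume "j mod 16 = k mod 16"
  then have "\<zeta> j = \<zeta> k" by (rule \<zeta>_mod)
  then show "[\<zeta> j = \<zeta> k] (mod int p)" by simp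
qed

lemma two_s: "[2 * s = \<zeta> 2 + \<zeta> (- 2)] (mod int p)"
proof -
  have "[\<zeta> (- 2) = - (z ^ 6)] (mod int p)"
    using \<zeta>_add_8[of 6] \<zeta>_mod[of "- 2" 14] by (simp add: \<zeta>_def)
  moreover have "\<zeta> 2 = z ^ 2" by (simp add: \<zeta>_def)
  ultimately show ?thesis using s unfolding cong_iff_dvd_diff by Groebner_Basis.algebra
qed

lemma two_s_squared: "[2 * s * s = 1] (mod int p)"
proof -
  have "[z ^ 8 + 1 = 0] (mod int p)" using z8 by (simp add: cong_iff_dvd_diff)
  with s have "int p dvd 2 * (2 * s * s - 1)"
    unfolding cong_iff_dvd_diff by Groebner_Basis.algebra
  then show ?thesis using not_dvd_2 by (simp only: dvd_mult_iff cong_iff_dvd_diff simp_thms)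
qed

lemma s_nonzero: "\<not> int p dvd s"
proof
  assume "int p dvd s"
  with two_s_squared have "int p dvd 1" unfolding cong_iff_dvd_diff by Groebner_Basis.algebra
  then show False using not_dvd_1 by simp
qed

text \<open>
  These three families, for exponents of suitable parity, contain the elements of the binary
  octahedral group \<open>H\<close> and of \<open>x H x\<close>. In a field with complex conjugation they would be
  unitary: each has rows \<open>(u, v)\<close> and \<open>(- v', u')\<close>, where the prime replaces \<open>z\<close> by its inverse.
\<close>

definition diag :: "int \<Rightarrow> int ^ 2 ^ 2"
  where "diag m = mat2 p (\<zeta> m) 0 0 (\<zeta> (- m))"

definition antidiag :: "int \<Rightarrow> int ^ 2 ^ 2"
  where "antidiag n = mat2 p 0 (\<zeta> n) (- \<zeta> (- n)) 0"

definition full :: "int \<Rightarrow> int \<Rightarrow> int ^ 2 ^ 2"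
  where "full m n = mat2 p (s * \<zeta> m) (s * \<zeta> n) (- (s * \<zeta> (- n))) (s * \<zeta> (- m))"

lemma mod_16_uminus: "m mod 16 = n mod 16 \<Longrightarrow> (- m) mod 16 = (- n) mod (16::int)"
  by (rule mod_minus_cong)

lemma diag_eq_iff: "diag m = diag n \<longleftrightarrow> m mod 16 = n mod 16"
  using mod_16_uminus[of m n] by (auto simp: diag_def mat2_eq_iff \<zeta>_eq_iff)

lemma antidiag_eq_iff: "antidiag m = antidiag n \<longleftrightarrow> m mod 16 = n mod 16"
  using mod_16_uminus[of m n] by (auto simp: antidiag_def mat2_eq_iff \<zeta>_eq_iff cong_minus_minus_iff)

lemma full_eq_iff: "full m n = full m' n' \<longleftrightarrow> m mod 16 = m' mod 16 \<and> n mod 16 = n' mod 16"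
proof
  assume "full m n = full m' n'"
  then have "[\<zeta> m = \<zeta> m'] (mod int p)" "[\<zeta> n = \<zeta> n'] (mod int p)"
    using cong_mult_cancel[OF _ s_nonzero] by (auto simp: full_def mat2_eq_iff)
  then show "m mod 16 = m' mod 16 \<and> n mod 16 = n' mod 16" by (simp add: \<zeta>_eq_iff)
next
  assume "m mod 16 = m' mod 16 \<and> n mod 16 = n' mod 16"
  then have "\<zeta> m = \<zeta> m'" "\<zeta> n = \<zeta> n'" "\<zeta> (- m) = \<zeta> (- m')" "\<zeta> (- n) = \<zeta> (- n')"
    using \<zeta>_mod mod_16_uminus by blast+
  then show "full m n = full m' n'" by (simp add: full_def)
qed

lemma diag_neq_antidiag: "diag m \<noteq> antidiag n"
  and diag_neq_full: "diag m \<noteq> full i j" and antidiag_neq_full: "antidiag n \<noteq> full i j"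
  using \<zeta>_nonzero s_nonzero
  by (auto simp: diag_def antidiag_def full_def mat2_eq_iff cong_iff_dvd_diff dvd_mult_iff)

lemma diag_in_SL2: "diag m \<in> carrier (SL2 p)" and antidiag_in_SL2: "antidiag n \<in> carrier (SL2 p)"
  using \<zeta>_inverse by (simp_all add: diag_def antidiag_def mat2_in_SL2_iff p_pos)

lemma full_in_SL2: "full m n \<in> carrier (SL2 p)"
  using \<zeta>_inverse[of m] \<zeta>_inverse[of n] two_s_squared
  unfolding full_def mat2_in_SL2_iff[OF p_pos] cong_iff_dvd_diff by Groebner_Basis.algebra

lemma diag_mult_diag: "diag a \<otimes>\<^bsub>SL2 p\<^esub> diag c = diag (a + c)"
  using \<zeta>_add[of a c] \<zeta>_add[of "- a" "- c"]
  by (simp add: diag_def mult_mat2 mat2_eq_iff cong_sym)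

lemma diag_mult_antidiag: "diag a \<otimes>\<^bsub>SL2 p\<^esub> antidiag b = antidiag (a + b)"
  using \<zeta>_add[of a b] \<zeta>_add[of "- a" "- b"]
  by (simp add: diag_def antidiag_def mult_mat2 mat2_eq_iff cong_sym cong_minus_minus_iff)

lemma antidiag_mult_diag: "antidiag b \<otimes>\<^bsub>SL2 p\<^esub> diag a = antidiag (b - a)"
  using \<zeta>_diff[of b a] \<zeta>_add[of "- b" a]
  by (simp add: diag_def antidiag_def mult_mat2 mat2_eq_iff cong_sym cong_minus_minus_iff)

lemma antidiag_mult_antidiag: "antidiag b \<otimes>\<^bsub>SL2 p\<^esub> antidiag d = diag (b - d + 8)"
proof -
  have 1: "[\<zeta> (b - d + 8) = - (\<zeta> b * \<zeta> (- d))] (mod int p)"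
    using \<zeta>_diff[of b d] \<zeta>_add_8[of "b - d"] unfolding cong_iff_dvd_diff by Groebner_Basis.algebra
  have "\<zeta> (- (b - d + 8)) = \<zeta> (d - b + 8)" by (rule \<zeta>_mod) (simp add: mod_eq_dvd_iff)
  moreover have "[\<zeta> (d - b + 8) = - (\<zeta> (- b) * \<zeta> d)] (mod int p)"
    using \<zeta>_diff[of d b] \<zeta>_add_8[of "d - b"] unfolding cong_iff_dvd_diff by Groebner_Basis.algebra
  ultimately show ?thesis
    using 1 by (simp add: diag_def antidiag_def mult_mat2 mat2_eq_iff cong_sym)
qed

lemma diag_mult_full: "diag a \<otimes>\<^bsub>SL2 p\<^esub> full c d = full (a + c) (a + d)"
proof -
  have e: "- (a + c) = - a + - c" "- (a + d) = - a + - d" by simp_all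
  show ?thesis
    using \<zeta>_add[of a c] \<zeta>_add[of a d] \<zeta>_add[of "- a" "- c"] \<zeta>_add[of "- a" "- d"]
    unfolding diag_def full_def mult_mat2 mat2_eq_iff cong_iff_dvd_diff e
    by (intro conjI; Groebner_Basis.algebra)
qed

lemma full_mult_diag: "full c d \<otimes>\<^bsub>SL2 p\<^esub> diag a = full (c + a) (d - a)"
proof -
  have e: "- (c + a) = - c + - a" "- (d - a) = - d + a" by simp_all
  show ?thesis
    using \<zeta>_add[of c a] \<zeta>_diff[of d a] \<zeta>_add[of "- c" "- a"] \<zeta>_add[of "- d" a]
    unfolding diag_def full_def mult_mat2 mat2_eq_iff cong_iff_dvd_diff e
    by (intro conjI; Groebner_Basis.algebra)
qed

lemma antidiag_mult_full: "antidiag b \<otimes>\<^bsub>SL2 p\<^esub> full c d = full (b - d + 8) (b - c)"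
proof -
  have e: "\<zeta> (- (b - d + 8)) = \<zeta> (d - b + 8)" "\<zeta> (- (b - c)) = \<zeta> (c - b)"
    by (rule \<zeta>_mod, simp add: mod_eq_dvd_iff)+
  show ?thesis
    using \<zeta>_diff[of b d] \<zeta>_add_8[of "b - d"] \<zeta>_diff[of d b] \<zeta>_add_8[of "d - b"]
      \<zeta>_diff[of b c] \<zeta>_diff[of c b]
    unfolding antidiag_def full_def mult_mat2 mat2_eq_iff cong_iff_dvd_diff e
    by (intro conjI; Groebner_Basis.algebra)
qed

lemma full_mult_antidiag: "full c d \<otimes>\<^bsub>SL2 p\<^esub> antidiag b = full (d - b + 8) (c + b)"
proof -
  have e: "\<zeta> (- (d - b + 8)) = \<zeta> (b - d + 8)" "\<zeta> (- (c + b)) = \<zeta> (- c - b)"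
    by (rule \<zeta>_mod, simp add: mod_eq_dvd_iff)+
  show ?thesis
    using \<zeta>_diff[of b d] \<zeta>_add_8[of "b - d"] \<zeta>_diff[of d b] \<zeta>_add_8[of "d - b"]
      \<zeta>_add[of c b] \<zeta>_diff[of "- c" b]
    unfolding antidiag_def full_def mult_mat2 mat2_eq_iff cong_iff_dvd_diff e
    by (intro conjI; Groebner_Basis.algebra)
qed

lemma full_mult_full:
  "full a b \<otimes>\<^bsub>SL2 p\<^esub> full c d =
    mat2 p (s * s * (\<zeta> (a + c) - \<zeta> (b - d))) (s * s * (\<zeta> (a + d) + \<zeta> (b - c)))
      (- (s * s * (\<zeta> (- (a + d)) + \<zeta> (- (b - c))))) (s * s * (\<zeta> (- (a + c)) - \<zeta> (- (b - d))))"
proof -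
  have e: "- (a + c) = - a + - c" "- (b - d) = - b + d" "- (a + d) = - a + - d" "- (b - c) = - b + c"
    by simp_all
  show ?thesis
    using \<zeta>_add[of a c] \<zeta>_add[of a d] \<zeta>_add[of "- a" "- c"] \<zeta>_add[of "- a" "- d"]
      \<zeta>_diff[of b d] \<zeta>_diff[of b c] \<zeta>_add[of "- b" d] \<zeta>_add[of "- b" c]
    unfolding full_def mult_mat2 mat2_eq_iff cong_iff_dvd_diff e
    by (intro conjI; Groebner_Basis.algebra)
qed

lemma \<zeta>_sum_4: "[s * s * (\<zeta> k + \<zeta> (k - 4)) = s * \<zeta> (k - 2)] (mod int p)"
proof -
  have "[\<zeta> k = \<zeta> (k - 2) * \<zeta> 2] (mod int p)" using \<zeta>_add[of "k - 2" 2] by simp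
  moreover have "[\<zeta> (k - 4) = \<zeta> (k - 2) * \<zeta> (- 2)] (mod int p)"
    using \<zeta>_add[of "k - 2" "- 2"] by simp
  ultimately show ?thesis
    using two_s two_s_squared unfolding cong_iff_dvd_diff by Groebner_Basis.algebra
qed

lemma \<zeta>_sum_4': "[s * s * (\<zeta> k + \<zeta> (k + 4)) = s * \<zeta> (k + 2)] (mod int p)"
  using \<zeta>_sum_4[of "k + 4"] by (simp add: add.commute)

text \<open>
  Each entry of the product is \<open>1 / 2\<close> times a sum of two powers of \<open>z\<close>. When the two exponents are
  congruent modulo 4, the quotient of the powers is a fourth root of unity, and the sum is \<open>0\<close>, twice a
  power or \<open>\<surd>2\<close> times a power. The four lemmas are the four possible quotients in the upper right entry.
\<close>

lemma full_mult_full_cases: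
  "(b - c) mod 16 = (a + d) mod 16 \<Longrightarrow> full a b \<otimes>\<^bsub>SL2 p\<^esub> full c d = antidiag (a + d)"
  "(b - c) mod 16 = (a + d + 8) mod 16 \<Longrightarrow> full a b \<otimes>\<^bsub>SL2 p\<^esub> full c d = diag (a + c)"
  "(b - c) mod 16 = (a + d - 4) mod 16 \<Longrightarrow> full a b \<otimes>\<^bsub>SL2 p\<^esub> full c d = full (a + c + 2) (a + d - 2)"
  "(b - c) mod 16 = (a + d + 4) mod 16 \<Longrightarrow> full a b \<otimes>\<^bsub>SL2 p\<^esub> full c d = full (a + c - 2) (a + d + 2)"
proof -
  define k where "k = a + d"
  define l where "l = a + c"
  have prod: "full a b \<otimes>\<^bsub>SL2 p\<^esub> full c d =
    mat2 p (s * s * (\<zeta> l - \<zeta> (b - d))) (s * s * (\<zeta> k + \<zeta> (b - c)))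
      (- (s * s * (\<zeta> (- k) + \<zeta> (- (b - c))))) (s * s * (\<zeta> (- l) - \<zeta> (- (b - d))))"
    by (simp only: full_mult_full k_def l_def)
  have neg: "[\<zeta> (j + 8) = - \<zeta> j] (mod int p)" for j by (rule \<zeta>_add_8)
  have diff_4: "[s * s * (\<zeta> j - \<zeta> (j + 4 + 8)) = s * \<zeta> (j + 2)] (mod int p)"
    "[s * s * (\<zeta> j - \<zeta> (j - 4 + 8)) = s * \<zeta> (j - 2)] (mod int p)" for j
    using \<zeta>_sum_4[of j] \<zeta>_sum_4'[of j] neg[of "j + 4"] neg[of "j - 4"]
    unfolding cong_iff_dvd_diff by Groebner_Basis.algebra+
  have neg_sum: "[s * s * (\<zeta> j + \<zeta> (j + 8)) = 0] (mod int p)" for j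
      using neg[of j] unfolding cong_iff_dvd_diff by Groebner_Basis.algebra
  have neg_diff: "[s * s * (\<zeta> j - \<zeta> (j + 8)) = \<zeta> j] (mod int p)" for j
      using neg[of j] two_s_squared unfolding cong_iff_dvd_diff by Groebner_Basis.algebra
  {
    assume "(b - c) mod 16 = (a + d) mod 16"
    then obtain t where t: "b - c - (a + d) = 16 * t" unfolding mod_eq_dvd_iff by (rule dvdE)
    have e: "\<zeta> (b - c) = \<zeta> k" "\<zeta> (b - d) = \<zeta> l"
      "\<zeta> (- (b - c)) = \<zeta> (- k)" "\<zeta> (- (b - d)) = \<zeta> (- l)"
      subgoal by (rule \<zeta>_shift[where t = "t"], use t in \<open>simp add: k_def l_def\<close>)
      subgoal by (rule \<zeta>_shift[where t = "t"], use t in \<open>simp add: k_def l_def\<close>)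
      subgoal by (rule \<zeta>_shift[where t = "- t"], use t in \<open>simp add: k_def l_def\<close>)
      subgoal by (rule \<zeta>_shift[where t = "- t"], use t in \<open>simp add: k_def l_def\<close>)
      done
    have "full a b \<otimes>\<^bsub>SL2 p\<^esub> full c d = antidiag k"
      unfolding prod e antidiag_def mat2_eq_iff using two_s_squared
      unfolding cong_iff_dvd_diff by (intro conjI; (Groebner_Basis.algebra | simp))
    then show "full a b \<otimes>\<^bsub>SL2 p\<^esub> full c d = antidiag (a + d)" by (simp add: k_def)
  }
  {
    assume "(b - c) mod 16 = (a + d + 8) mod 16"
    then obtain t where t: "b - c - (a + d + 8) = 16 * t" unfolding mod_eq_dvd_iff by (rule dvdE)
    have e: "\<zeta> (b - c) = \<zeta> (k + 8)" "\<zeta> (b - d) = \<zeta> (l + 8)"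
      "\<zeta> (- (b - c)) = \<zeta> (- k + 8)" "\<zeta> (- (b - d)) = \<zeta> (- l + 8)"
      subgoal by (rule \<zeta>_shift[where t = "t"], use t in \<open>simp add: k_def l_def\<close>)
      subgoal by (rule \<zeta>_shift[where t = "t"], use t in \<open>simp add: k_def l_def\<close>)
      subgoal by (rule \<zeta>_shift[where t = "- t - 1"], use t in \<open>simp add: k_def l_def\<close>)
      subgoal by (rule \<zeta>_shift[where t = "- t - 1"], use t in \<open>simp add: k_def l_def\<close>)
      done
    have "full a b \<otimes>\<^bsub>SL2 p\<^esub> full c d = diag l"
      unfolding prod e diag_def mat2_eq_iff
      using neg_sum[of k] neg_diff[of l] neg_sum[of "- k"] neg_diff[of "- l"]
      by (simp add: cong_0_iff)
    then show "full a b \<otimes>\<^bsub>SL2 p\<^esub> full c d = diag (a + c)" by (simp add: l_def)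
  }
  {
    assume "(b - c) mod 16 = (a + d - 4) mod 16"
    then obtain t where t: "b - c - (a + d - 4) = 16 * t" unfolding mod_eq_dvd_iff by (rule dvdE)
    have e: "\<zeta> (b - c) = \<zeta> (k - 4)" "\<zeta> (b - d) = \<zeta> (l + 4 + 8)"
      "\<zeta> (- (b - c)) = \<zeta> (- k + 4)" "\<zeta> (- (b - d)) = \<zeta> (- l - 4 + 8)"
      subgoal by (rule \<zeta>_shift[where t = "t"], use t in \<open>simp add: k_def l_def\<close>)
      subgoal by (rule \<zeta>_shift[where t = "t - 1"], use t in \<open>simp add: k_def l_def\<close>)
      subgoal by (rule \<zeta>_shift[where t = "- t"], use t in \<open>simp add: k_def l_def\<close>)
      subgoal by (rule \<zeta>_shift[where t = "- t"], use t in \<open>simp add: k_def l_def\<close>)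
      done
    have u: "- (l + 2) = - l - 2" "- (k - 2) = - k + 2" by simp_all
    have "full a b \<otimes>\<^bsub>SL2 p\<^esub> full c d = full (l + 2) (k - 2)"
      unfolding prod e unfolding full_def mat2_eq_iff u
      by (intro conjI cong_minus_minus_iff[THEN iffD2] diff_4 \<zeta>_sum_4 \<zeta>_sum_4')
    then show "full a b \<otimes>\<^bsub>SL2 p\<^esub> full c d = full (a + c + 2) (a + d - 2)" by (simp add: k_def l_def)
  }
  {
    assume "(b - c) mod 16 = (a + d + 4) mod 16"
    then obtain t where t: "b - c - (a + d + 4) = 16 * t" unfolding mod_eq_dvd_iff by (rule dvdE)
    have e: "\<zeta> (b - c) = \<zeta> (k + 4)" "\<zeta> (b - d) = \<zeta> (l - 4 + 8)"
      "\<zeta> (- (b - c)) = \<zeta> (- k - 4)" "\<zeta> (- (b - d)) = \<zeta> (- l + 4 + 8)"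
      subgoal by (rule \<zeta>_shift[where t = "t"], use t in \<open>simp add: k_def l_def\<close>)
      subgoal by (rule \<zeta>_shift[where t = "t"], use t in \<open>simp add: k_def l_def\<close>)
      subgoal by (rule \<zeta>_shift[where t = "- t"], use t in \<open>simp add: k_def l_def\<close>)
      subgoal by (rule \<zeta>_shift[where t = "- t - 1"], use t in \<open>simp add: k_def l_def\<close>)
      done
    have u: "- (l - 2) = - l + 2" "- (k + 2) = - k - 2" by simp_all
    have "full a b \<otimes>\<^bsub>SL2 p\<^esub> full c d = full (l - 2) (k + 2)"
      unfolding prod e unfolding full_def mat2_eq_iff u
      by (intro conjI cong_minus_minus_iff[THEN iffD2] diff_4 \<zeta>_sum_4 \<zeta>_sum_4')
    then show "full a b \<otimes>\<^bsub>SL2 p\<^esub> full c d = full (a + c - 2) (a + d + 2)" by (simp add: k_def l_def)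
  }
qed

text \<open>
  With the exponents off by two, the product of the diagonal entries is \<open>(2 - t) / 4\<close>, where
  \<open>t\<close> is the sum of a primitive eighth root of unity and its inverse; so \<open>t\<^sup>2 = 2\<close>. Membership in
  one of the three families would give the product \<open>1\<close>, \<open>0\<close> or \<open>1 / 2\<close>, that is \<open>t = - 2\<close>, \<open>2\<close> or
  \<open>0\<close>, and then \<open>p\<close> would divide 2.
\<close>

lemma full_mult_full_irregular:
  assumes e: "(a + m - b + n) mod 4 = 2"
  shows "full a b \<otimes>\<^bsub>SL2 p\<^esub> full m n \<notin> range diag \<union> range antidiag \<union> range (\<lambda>(i, j). full i j)"
proof
  define k l where "k = a + m" and "l = b - n"
  define t where "t = \<zeta> k * \<zeta> (- l) + \<zeta> (- k) * \<zeta> l"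
  define q where "q = (k - l) div 4"
  have "(k - l) mod 4 = 2" using e by (simp add: k_def l_def algebra_simps)
  then have "k - l = 4 * q + 2" unfolding q_def by presburger
  then have "- (2 * (k - l)) - (2 * (k - l) + 8) = 16 * (- q - 1)" by simp
  then have "(- (2 * (k - l))) mod 16 = (2 * (k - l) + 8) mod 16"
    unfolding mod_eq_dvd_iff by (rule dvdI)
  then have "\<zeta> (- (2 * (k - l))) = \<zeta> (2 * (k - l) + 8)" by (rule \<zeta>_mod)
  with \<zeta>_add_8[of "2 * (k - l)"] have *: "[\<zeta> (- (2 * (k - l))) = - \<zeta> (2 * (k - l))] (mod int p)"
    by simp
  have 1: "[\<zeta> (2 * (k - l)) = (\<zeta> k * \<zeta> (- l)) ^ 2] (mod int p)"
    using \<zeta>_add[of "k - l" "k - l"] \<zeta>_diff[of k l]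
    unfolding cong_iff_dvd_diff mult_2[of "k - l"] by Groebner_Basis.algebra
  have 2: "[\<zeta> (- (2 * (k - l))) = (\<zeta> (- k) * \<zeta> l) ^ 2] (mod int p)"
    using \<zeta>_add[of "l - k" "l - k"] \<zeta>_diff[of l k]
    unfolding cong_iff_dvd_diff by (simp add: algebra_simps) Groebner_Basis.algebra
  have t: "int p dvd t ^ 2 - 2"
    using * 1 2 \<zeta>_inverse[of k] \<zeta>_inverse[of l] unfolding cong_iff_dvd_diff t_def by Groebner_Basis.algebra
  have t_neq: "\<not> int p dvd t" "\<not> int p dvd t + 2" "\<not> int p dvd t - 2"
  proof -
    have "int p dvd 2" if "int p dvd t \<or> int p dvd t + 2 \<or> int p dvd t - 2"
      using that
    proof (elim disjE)
      assume "int p dvd t" with t show ?thesis by Groebner_Basis.algebra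
    next
      assume "int p dvd t + 2" with t show ?thesis by Groebner_Basis.algebra
    next
      assume "int p dvd t - 2" with t show ?thesis by Groebner_Basis.algebra
    qed
    then show "\<not> int p dvd t" "\<not> int p dvd t + 2" "\<not> int p dvd t - 2" using not_dvd_2 by blast+
  qed
  have key: "int p dvd 4 * (\<alpha> * \<delta>) - (2 - t)"
    if "full a b \<otimes>\<^bsub>SL2 p\<^esub> full m n = mat2 p \<alpha> \<beta> \<gamma> \<delta>" for \<alpha> \<beta> \<gamma> \<delta>
  proof -
    have "[s * s * (\<zeta> k - \<zeta> l) = \<alpha>] (mod int p)" "[s * s * (\<zeta> (- k) - \<zeta> (- l)) = \<delta>] (mod int p)"
      using that unfolding full_mult_full mat2_eq_iff k_def l_def by auto
    then show ?thesis
      using two_s_squared \<zeta>_inverse[of k] \<zeta>_inverse[of l] unfolding cong_iff_dvd_diff t_def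
      by Groebner_Basis.algebra
  qed
  assume "full a b \<otimes>\<^bsub>SL2 p\<^esub> full m n \<in> range diag \<union> range antidiag \<union> range (\<lambda>(i, j). full i j)"
  then consider i where "full a b \<otimes>\<^bsub>SL2 p\<^esub> full m n = diag i" | i where "full a b \<otimes>\<^bsub>SL2 p\<^esub> full m n = antidiag i"
    | i j where "full a b \<otimes>\<^bsub>SL2 p\<^esub> full m n = full i j" by auto
  then show False
  proof cases
    case (1 i)
    from key[OF trans[OF 1 diag_def]] \<zeta>_inverse[of i] have "int p dvd t + 2"
      unfolding cong_iff_dvd_diff by Groebner_Basis.algebra
    then show False using t_neq by simp
  next
    case (2 i)
    from key[OF trans[OF 2 antidiag_def]] have "int p dvd t - 2" by simp
    then show False using t_neq by simp
  next
    case (3 i j)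
    from key[OF trans[OF 3 full_def]] \<zeta>_inverse[of i] two_s_squared have "int p dvd t"
      unfolding cong_iff_dvd_diff by Groebner_Basis.algebra
    then show False using t_neq by simp
  qed
qed

end

section \<open>The binary octahedral group\<close>

context binary_octahedral
begin

text \<open>
  The binary octahedral group. The diagonal and antidiagonal elements form a generalised quaternion
  group of order 16, and the remaining 32 elements are the other two of its cosets.
\<close>

definition H :: "(int ^ 2 ^ 2) set"
  where "H = {diag m |m. even m} \<union> {antidiag n |n. even n} \<union> {full m n |m n. even m \<and> 4 dvd m - n}"

lemma H_cases:
  assumes "h \<in> H"
  obtains (diag) m where "h = diag m" "even m" | (antidiag) n where "h = antidiag n" "even n"
    | (full) m n where "h = full m n" "even m" "4 dvd m - n"
  using assms by (auto simp: H_def)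

lemma even_mod_16: "m mod 16 = n mod (16 :: int) \<Longrightarrow> even m \<Longrightarrow> even n"
  by presburger

lemma diag_in_H_iff: "diag m \<in> H \<longleftrightarrow> even m"
proof
  assume "diag m \<in> H"
  then obtain n where "diag m = diag n" "even n"
    by (auto simp: H_def diag_neq_antidiag diag_neq_full)
  then show "even m" using even_mod_16[of n m] by (simp add: diag_eq_iff)
qed (auto simp: H_def)

lemma antidiag_in_H_iff: "antidiag m \<in> H \<longleftrightarrow> even m"
proof
  assume "antidiag m \<in> H"
  then obtain n where "antidiag m = antidiag n" "even n"
    by (auto simp: H_def diag_neq_antidiag[symmetric] antidiag_neq_full)
  then show "even m" using even_mod_16[of n m] by (simp add: antidiag_eq_iff)
qed (auto simp: H_def)

lemma dvd_diff_mod_16: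
  assumes "m mod 16 = m' mod 16" "n mod 16 = n' mod 16" "4 dvd m - n"
  shows "4 dvd m' - (n' :: int)"
proof -
  have "4 dvd m - m'" "4 dvd n - n'"
    using assms(1,2) unfolding mod_eq_dvd_iff by (auto elim: dvd_trans[rotated])
  moreover have "m' - n' = (m - n) - (m - m') + (n - n')" by simp
  ultimately show ?thesis using assms(3) by (metis dvd_add dvd_diff)
qed

lemma full_in_H_iff: "full m n \<in> H \<longleftrightarrow> even m \<and> 4 dvd m - n"
proof
  assume "full m n \<in> H"
  then obtain m' n' where "full m n = full m' n'" "even m'" "4 dvd m' - n'"
    by (auto simp: H_def diag_neq_full[symmetric] antidiag_neq_full[symmetric])
  moreover from this have "m' mod 16 = m mod 16" "n' mod 16 = n mod 16" by (simp_all add: full_eq_iff)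
  ultimately show "even m \<and> 4 dvd m - n" using dvd_diff_mod_16 even_mod_16 by blast
qed (auto simp: H_def)

lemma diag_0: "diag 0 = \<one>\<^bsub>SL2 p\<^esub>"
  by (simp add: diag_def one_mat2)

lemma H_subset: "H \<subseteq> carrier (SL2 p)"
  by (auto simp: H_def diag_in_SL2 antidiag_in_SL2 full_in_SL2)

lemma full_mult_full_in_H:
  assumes "full a b \<in> H" "full c d \<in> H"
  shows "full a b \<otimes>\<^bsub>SL2 p\<^esub> full c d \<in> H"
proof -
  have ev: "even a" "even c" "4 dvd a - b" "4 dvd c - d" using assms by (simp_all add: full_in_H_iff)
  then obtain a' c' i j where *: "a = 2 * a'" "c = 2 * c'" "a - b = 4 * i" "c - d = 4 * j"
    by (auto elim!: evenE dvdE)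
  define l where "l = j - i - c'"
  define q where "q = l div 4"
  have bc: "b - c = a + d + 4 * l"
    using * by (simp add: l_def)
  have "l = 4 * q \<or> l = 4 * q + 2 \<or> l = 4 * q + 3 \<or> l = 4 * q + 1"
    unfolding q_def by presburger
  then consider "l = 4 * q" | "l = 4 * q + 2" | "l = 4 * q + 3" | "l = 4 * q + 1"
    by blast
  then show ?thesis
  proof cases
    case 1
    then have "(b - c) mod 16 = (a + d) mod 16" by (simp add: mod_eq_dvd_iff bc)
    moreover have "even (a + d)" using * by presburger
    ultimately show ?thesis by (simp add: full_mult_full_cases antidiag_in_H_iff)
  next
    case 2
    then have "(b - c) mod 16 = (a + d + 8) mod 16" by (simp add: mod_eq_dvd_iff bc)
    then show ?thesis using ev by (simp add: full_mult_full_cases diag_in_H_iff)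
  next
    case 3
    then have "(b - c) mod 16 = (a + d - 4) mod 16" by (simp add: mod_eq_dvd_iff bc)
    moreover have "a + c + 2 - (a + d - 2) = 4 * (j + 1)" using * by simp
    then have "4 dvd a + c + 2 - (a + d - 2)" by (rule dvdI)
    ultimately show ?thesis using ev by (simp add: full_mult_full_cases full_in_H_iff)
  next
    case 4
    then have "(b - c) mod 16 = (a + d + 4) mod 16" by (simp add: mod_eq_dvd_iff bc)
    moreover have "a + c - 2 - (a + d + 2) = 4 * (j - 1)" using * by simp
    then have "4 dvd a + c - 2 - (a + d + 2)" by (rule dvdI)
    ultimately show ?thesis using ev by (simp add: full_mult_full_cases full_in_H_iff)
  qed
qed

lemma subgroup_H: "subgroup H (SL2 p)"
proof (rule SL2.subgroupI)
  show "H \<subseteq> carrier (SL2 p)" by (rule H_subset)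
  show "H \<noteq> {}" using diag_in_H_iff[of 0] by auto
  show "inv\<^bsub>SL2 p\<^esub> h \<in> H" if "h \<in> H" for h
    using that
  proof (cases rule: H_cases)
    case (diag m)
    have "inv\<^bsub>SL2 p\<^esub> diag m = diag (- m)"
      by (rule SL2.inv_equality) (simp_all add: diag_mult_diag diag_0 diag_in_SL2)
    then show ?thesis using diag by (simp add: diag_in_H_iff)
  next
    case (antidiag n)
    have "antidiag (n + 8) \<otimes>\<^bsub>SL2 p\<^esub> antidiag n = diag 0" by (simp add: antidiag_mult_antidiag diag_eq_iff)
    then have "inv\<^bsub>SL2 p\<^esub> antidiag n = antidiag (n + 8)"
      by (intro SL2.inv_equality) (simp_all add: diag_0 antidiag_in_SL2)
    then show ?thesis using antidiag by (simp add: antidiag_in_H_iff)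
  next
    case (full m n)
    have "full (- m) (n + 8) \<otimes>\<^bsub>SL2 p\<^esub> full m n = diag (- m + m)"
      by (rule full_mult_full_cases(2)) (simp add: mod_eq_dvd_iff)
    then have "inv\<^bsub>SL2 p\<^esub> full m n = full (- m) (n + 8)"
      by (intro SL2.inv_equality) (simp_all add: diag_0 full_in_SL2)
    moreover have "4 dvd - m - (n + 8)"
      using full by presburger
    ultimately show ?thesis using full by (simp add: full_in_H_iff)
  qed
  show "h \<otimes>\<^bsub>SL2 p\<^esub> k \<in> H" if "h \<in> H" "k \<in> H" for h k
    using that(1)
  proof (cases rule: H_cases)
    case (diag a)
    show ?thesis
      using that(2) by (cases rule: H_cases)
        (simp_all add: diag diag_mult_diag diag_mult_antidiag diag_mult_full diag_in_H_iff antidiag_in_H_iff full_in_H_iff)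
  next
    case (antidiag b)
    show ?thesis
      using that(2)
    proof (cases rule: H_cases)
      case (full m n)
      have "even n" "4 dvd b - n + 8 - (b - m)" using full by presburger+
      then show ?thesis using full antidiag by (simp add: antidiag_mult_full full_in_H_iff)
    qed (simp_all add: antidiag antidiag_mult_diag antidiag_mult_antidiag diag_in_H_iff antidiag_in_H_iff)
  next
    case (full a b)
    have par: "even b" using full by presburger
    show ?thesis
      using that(2)
    proof (cases rule: H_cases)
      case (diag c)
      have "4 dvd a + c - (b - c)" using full diag by presburger
      then show ?thesis using full diag by (simp add: full_mult_diag full_in_H_iff)
    next
      case (antidiag d)
      have "4 dvd b - d + 8 - (a + d)" using full antidiag by presburger
      then show ?thesis using full antidiag par by (simp add: full_mult_antidiag full_in_H_iff)
    next
      case (full c d)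
      then show ?thesis using full_mult_full_in_H that \<open>h = full a b\<close> by simp
    qed
  qed
qed

lemma diag_image: "{diag m |m. even m} = (\<lambda>i. diag (2 * i)) ` {0..<8}"
  and antidiag_image: "{antidiag m |m. even m} = (\<lambda>i. antidiag (2 * i)) ` {0..<8}"
proof -
  have "\<exists>i\<in>{0..<8}. m mod 16 = (2 * i) mod 16" if "even m" for m :: int
  proof (intro bexI)
    show "m div 2 mod 8 \<in> {0..<8}" by simp
    show "m mod 16 = (2 * (m div 2 mod 8)) mod 16" using that by (simp add: mult_mod_right)
  qed
  then show "{diag m |m. even m} = (\<lambda>i. diag (2 * i)) ` {0..<8}" "{antidiag m |m. even m} = (\<lambda>i. antidiag (2 * i)) ` {0..<8}"
    by (auto simp: image_iff diag_eq_iff antidiag_eq_iff)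
qed

lemma full_image: "{full m n |m n. even m \<and> 4 dvd m - n} = (\<lambda>(i, j). full (2 * i) (2 * i + 4 * j)) ` ({0..<8} \<times> {0..<4})"
proof (intro Set.set_eqI iffI)
  fix h assume "h \<in> {full m n |m n. even m \<and> 4 dvd m - n}"
  then obtain m n where h: "h = full m n" "even m" "4 dvd m - n" by blast
  define i where "i = m div 2 mod 8"
  define j where "j = (n - 2 * i) div 4 mod 4"
  have i: "m mod 16 = (2 * i) mod 16" using h(2) by (simp add: i_def mult_mod_right)
  then have "4 dvd n - 2 * i"
    using dvd_diff_mod_16[OF i refl h(3)] by (simp add: dvd_diff_commute)
  then have "4 * j = (n - 2 * i) mod 16" by (simp add: j_def mult_mod_right)
  then have "n mod 16 = (2 * i + 4 * j) mod 16" by (simp add: mod_add_right_eq)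
  with i have "h = full (2 * i) (2 * i + 4 * j)" by (simp add: h full_eq_iff)
  moreover have "i \<in> {0..<8}" "j \<in> {0..<4}" by (simp_all add: i_def j_def)
  ultimately show "h \<in> (\<lambda>(i, j). full (2 * i) (2 * i + 4 * j)) ` ({0..<8} \<times> {0..<4})"
    by (intro image_eqI[where x = "(i, j)"]) simp_all
next
  fix h assume "h \<in> (\<lambda>(i, j). full (2 * i) (2 * i + 4 * j)) ` ({0..<8} \<times> {0..<4})"
  then obtain i j where "h = full (2 * i) (2 * i + 4 * j)" by auto
  moreover have "even (2 * i)" "4 dvd 2 * i - (2 * i + 4 * j)" by simp_all
  ultimately show "h \<in> {full m n |m n. even m \<and> 4 dvd m - n}" by blast
qed

lemma card_diag_even: "card {diag m |m. even m} = 8" and card_antidiag_even: "card {antidiag m |m. even m} = 8"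
  unfolding diag_image antidiag_image by (subst card_image; auto simp: inj_on_def diag_eq_iff antidiag_eq_iff)+

lemma card_full_even: "card {full m n |m n. even m \<and> 4 dvd m - n} = 32"
proof -
  have "inj_on (\<lambda>(i, j). full (2 * i) (2 * i + 4 * j)) ({0..<8} \<times> {0..<4})"
  proof (rule inj_onI, clarify)
    fix i j i' j' :: int
    assume r: "i \<in> {0..<8}" "i' \<in> {0..<8}" "j \<in> {0..<4}" "j' \<in> {0..<4}"
      and full: "full (2 * i) (2 * i + 4 * j) = full (2 * i') (2 * i' + 4 * j')"
    from full have e: "(2 * i) mod 16 = (2 * i') mod 16" "(2 * i + 4 * j) mod 16 = (2 * i' + 4 * j') mod 16"
      unfolding full_eq_iff by blast+
    from e(1) r have i: "i = i'" by simp
    with e(2) have "(4 * j) mod 16 = (4 * j') mod 16"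
      unfolding i mod_eq_dvd_iff by simp
    with r i show "i = i' \<and> j = j'" by simp
  qed
  then show ?thesis unfolding full_image by (simp add: card_image card_cartesian_product)
qed

lemma card_H: "card H = 48"
proof -
  have fin: "finite {diag m |m. even m}" "finite {antidiag m |m. even m}"
    "finite {full m n |m n. even m \<and> 4 dvd m - n}"
    unfolding diag_image antidiag_image full_image by simp_all
  have "{diag m |m. even m} \<inter> {antidiag m |m. even m} = {}"
    "({diag m |m. even m} \<union> {antidiag m |m. even m}) \<inter> {full m n |m n. even m \<and> 4 dvd m - n} = {}"
    using diag_neq_antidiag diag_neq_full antidiag_neq_full by blast+
  then show ?thesis
    unfolding H_def using fin by (simp add: card_Un_disjoint card_diag_even card_antidiag_even card_full_even)
qed

lemma finite_H: "finite H"
  by (rule card_ge_0_finite) (simp add: card_H)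

text \<open>
  Multiplication by \<open>diag 1\<close> on both sides shifts the first exponent by two and keeps the second.
\<close>

lemma translate_H:
  "two_sided_translate (SL2 p) H (diag 1) =
    {diag m |m. even m} \<union> {antidiag n |n. even n} \<union> {full m n |m n. even m \<and> 4 dvd m - n - 2}" (is "_ = ?R")
proof -
  have x_diag: "diag 1 \<otimes>\<^bsub>SL2 p\<^esub> diag m \<otimes>\<^bsub>SL2 p\<^esub> diag 1 = diag (m + 2)"
    and x_antidiag: "diag 1 \<otimes>\<^bsub>SL2 p\<^esub> antidiag m \<otimes>\<^bsub>SL2 p\<^esub> diag 1 = antidiag m"
    and x_full: "diag 1 \<otimes>\<^bsub>SL2 p\<^esub> full m n \<otimes>\<^bsub>SL2 p\<^esub> diag 1 = full (m + 2) n" for m n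
    by (simp_all add: diag_mult_diag diag_mult_antidiag diag_mult_full antidiag_mult_diag full_mult_diag add.commute)
  show ?thesis
  proof
    show "two_sided_translate (SL2 p) H (diag 1) \<subseteq> ?R"
    proof
      fix g assume "g \<in> two_sided_translate (SL2 p) H (diag 1)"
      then obtain h where h: "h \<in> H" and g: "g = diag 1 \<otimes>\<^bsub>SL2 p\<^esub> h \<otimes>\<^bsub>SL2 p\<^esub> diag 1"
        by (auto simp: two_sided_translate_def)
      from h show "g \<in> ?R"
      proof (cases rule: H_cases)
        case (diag m)
        then have "g = diag (m + 2)" "even (m + 2)" using g x_diag by simp_all
        then show ?thesis by blast
      next
        case (antidiag n)
        then show ?thesis using g x_antidiag by auto
      next
        case (full m n)
        then have "g = full (m + 2) n" "even (m + 2)" "4 dvd (m + 2) - n - 2"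
          using g x_full by simp_all
        then show ?thesis by blast
      qed
    qed
    have I: "diag 1 \<otimes>\<^bsub>SL2 p\<^esub> h \<otimes>\<^bsub>SL2 p\<^esub> diag 1 \<in> two_sided_translate (SL2 p) H (diag 1)" if "h \<in> H" for h
      using that by (auto simp: two_sided_translate_def)
    have "diag m \<in> two_sided_translate (SL2 p) H (diag 1)" if "even m" for m
      using I[of "diag (m - 2)"] that by (simp add: x_diag diag_in_H_iff)
    moreover have "antidiag m \<in> two_sided_translate (SL2 p) H (diag 1)" if "even m" for m
      using I[of "antidiag m"] that by (simp add: x_antidiag antidiag_in_H_iff)
    moreover have "full m n \<in> two_sided_translate (SL2 p) H (diag 1)" if "even m" "4 dvd m - n - 2" for m n
      using I[of "full (m - 2) n"] that by (simp add: x_full full_in_H_iff algebra_simps)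
    ultimately show "?R \<subseteq> two_sided_translate (SL2 p) H (diag 1)" by blast
  qed
qed

lemma H_inter_translate: "H \<inter> two_sided_translate (SL2 p) H (diag 1) = {diag m |m. even m} \<union> {antidiag n |n. even n}"
proof -
  have "full m n \<notin> H" if "4 dvd m - n - 2" for m n
    using that by (simp add: full_in_H_iff) presburger
  then show ?thesis unfolding translate_H by (auto simp: diag_in_H_iff antidiag_in_H_iff)
qed

lemma card_H_inter_translate: "card (H \<inter> two_sided_translate (SL2 p) H (diag 1)) = 16"
proof -
  have "finite {diag m |m. even m}" "finite {antidiag m |m. even m}"
    unfolding diag_image antidiag_image by simp_all
  moreover have "{diag m |m. even m} \<inter> {antidiag m |m. even m} = {}"
    using diag_neq_antidiag by blast
  ultimately show ?thesis
    unfolding H_inter_translate by (simp add: card_Un_disjoint card_diag_even card_antidiag_even)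
qed

text \<open>
  Suppose that \<open>g = h\<^sub>0 x k\<close> lies in \<open>x H x\<close>. Then \<open>h\<^sub>0\<^sup>-\<^sup>1 g = x k\<close> has odd exponents. If \<open>g\<close> is
  monomial, then \<open>g \<in> H\<close> and so \<open>x \<in> H\<close>. Otherwise \<open>h\<^sub>0\<^sup>-\<^sup>1 g\<close> has even exponents if \<open>h\<^sub>0\<close> is monomial,
  and lies outside all three families if it is not.
\<close>

lemma translate_double_coset_disjoint:
  "two_sided_translate (SL2 p) H (diag 1) \<inter> double_coset (SL2 p) H (diag 1) = {}"
proof (rule equals0I)
  interpret H: subgroup H "SL2 p" by (rule subgroup_H)
  fix g assume g: "g \<in> two_sided_translate (SL2 p) H (diag 1) \<inter> double_coset (SL2 p) H (diag 1)"
  then obtain h0 k where hk: "h0 \<in> H" "k \<in> H" "g = h0 \<otimes>\<^bsub>SL2 p\<^esub> diag 1 \<otimes>\<^bsub>SL2 p\<^esub> k"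
    by (auto simp: double_coset_def)
  define h where "h = inv\<^bsub>SL2 p\<^esub> h0"
  have h: "h \<in> H" using hk by (simp add: h_def)
  have hg: "h \<otimes>\<^bsub>SL2 p\<^esub> g = diag 1 \<otimes>\<^bsub>SL2 p\<^esub> k"
    using hk diag_in_SL2[of 1] by (simp add: h_def SL2.m_assoc) (simp flip: SL2.m_assoc)
  have xk: "(\<exists>m. odd m \<and> diag 1 \<otimes>\<^bsub>SL2 p\<^esub> k = diag m) \<or> (\<exists>m. odd m \<and> diag 1 \<otimes>\<^bsub>SL2 p\<^esub> k = antidiag m) \<or>
      (\<exists>m n. odd m \<and> diag 1 \<otimes>\<^bsub>SL2 p\<^esub> k = full m n)"
    using hk(2)
  proof (cases rule: H_cases)
    case (diag m)
    then have "odd (1 + m)" by simp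
    with diag show ?thesis by (metis diag_mult_diag)
  next
    case (antidiag m)
    then have "odd (1 + m)" by simp
    with antidiag show ?thesis by (metis diag_mult_antidiag)
  next
    case (full m n)
    then have "odd (1 + m)" by simp
    with full show ?thesis by (metis diag_mult_full)
  qed
  have g_cases: "g \<in> H \<or> (\<exists>m n. g = full m n \<and> even m \<and> 4 dvd m - n - 2)"
    using g unfolding translate_H by (auto simp: diag_in_H_iff antidiag_in_H_iff)
  have odd_full: "full m n \<noteq> full i j" if "even m" "odd i" for m n i j
  proof
    assume "full m n = full i j"
    then have "m mod 16 = i mod 16" by (simp add: full_eq_iff)
    with that show False by presburger
  qed
  from g_cases show False
  proof
    assume "g \<in> H"
    then have "diag 1 \<otimes>\<^bsub>SL2 p\<^esub> k \<in> H" using h hg by (metis H.m_closed)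
    then have "(diag 1 \<otimes>\<^bsub>SL2 p\<^esub> k) \<otimes>\<^bsub>SL2 p\<^esub> inv\<^bsub>SL2 p\<^esub> k \<in> H" using hk by blast
    then have "diag 1 \<in> H" using hk diag_in_SL2[of 1] by (simp add: SL2.m_assoc)
    then show False by (simp add: diag_in_H_iff)
  next
    assume "\<exists>m n. g = full m n \<and> even m \<and> 4 dvd m - n - 2"
    then obtain m n where gM: "g = full m n" "even m" "4 dvd m - n - 2" by blast
    then have n: "even n" by presburger
    from h show False
    proof (cases rule: H_cases)
      case (diag a)
      have "even (a + m)" using diag gM by simp
      moreover have "diag 1 \<otimes>\<^bsub>SL2 p\<^esub> k = full (a + m) (a + n)"
        using hg diag gM by (simp add: diag_mult_full)
      ultimately show False using xk odd_full diag_neq_full antidiag_neq_full by metis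
    next
      case (antidiag b)
      have "even (b - n + 8)" using antidiag n by simp
      moreover have "diag 1 \<otimes>\<^bsub>SL2 p\<^esub> k = full (b - n + 8) (b - m)"
        using hg antidiag gM by (simp add: antidiag_mult_full)
      ultimately show False using xk odd_full diag_neq_full antidiag_neq_full by metis
    next
      case (full a b)
      have "(a + m - b + n) mod 4 = 2"
      proof -
        obtain i j l where "a - b = 4 * i" "m - n - 2 = 4 * j" "n = 2 * l"
          using full(3) gM(3) n by (auto elim!: dvdE)
        then have "a + m - b + n = 2 + 4 * (i + j + l)" by simp
        then show ?thesis by (simp only: mod_mult_self2) simp
      qed
      from full_mult_full_irregular[OF this] have "diag 1 \<otimes>\<^bsub>SL2 p\<^esub> k \<notin> range diag \<union> range antidiag \<union> range (\<lambda>(i, j). full i j)"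
        using hg full gM by simp
      with xk show False by force
    qed
  qed
qed

section \<open>Generation of the special linear group\<close>

text \<open>
  If the subgroup is proper, it contains no unipotent elements up to sign other than the central ones,
  and it is partitioned by tori. The torus of \<open>diag 1\<close> contains all 16 diagonal matrices \<open>diag m\<close>;
  \<open>antidiag 0\<close> inverts it, while \<open>full 0 0\<close> does not normalise it.
\<close>

lemma subgroup_containing_H_and_root_is_SL2:
  assumes B: "subgroup B (SL2 p)" and HB: "H \<subseteq> B" and x: "diag 1 \<in> B"
  shows "B = carrier (SL2 p)"
proof (rule ccontr)
  assume proper: "B \<noteq> carrier (SL2 p)"
  interpret B: subgroup B "SL2 p" by (rule B)
  have in_B: "antidiag 0 \<in> B" "full 0 0 \<in> B"
    using HB by (auto simp: antidiag_in_H_iff full_in_H_iff subset_iff)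
  have diag: "mat2 p (\<zeta> 1) 0 0 (\<zeta> (- 1)) \<in> B" using x by (simp add: diag_def)
  have anti: "mat2 p 0 1 (- 1) 0 \<in> B" using in_B(1) by (simp add: antidiag_def)
  have ndvd: "\<not> int p dvd \<zeta> (- 1) - \<zeta> 1"
    using \<zeta>_eq_iff[of "- 1" 1] by (simp add: cong_iff_dvd_diff)
  have semisimple: "regular_semisimple u" if "u \<in> B - centre" for u
    using subgroup_with_unipotent_is_SL2[OF B diag ndvd anti] that proper by blast
  have minus_one: "mat2 p (- 1) 0 0 (- 1) = diag 8"
    using \<zeta>_8 \<zeta>_mod[of "- 8" 8] by (simp add: diag_def mat2_eq_iff cong_sym)
  have centre_eq: "centre = {diag 0, diag 8}"
    using minus_one by (simp add: centre_def diag_0 one_mat2)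
  have diag_pow: "diag (int k) \<in> B" for k
  proof (induction k)
    case 0
    then show ?case by (simp add: diag_0)
  next
    case (Suc k)
    from B.m_closed[OF x this] show ?case by (simp add: diag_mult_diag)
  qed
  have diag_in_B: "diag m \<in> B" for m
    using diag_pow[of "nat (m mod 16)"] diag_eq_iff[of m "m mod 16"] by simp
  define G where "G = SL2 p\<lparr>carrier := B\<rparr>"
  have G: "carrier G = B" "mult G = mult (SL2 p)" "one G = one (SL2 p)"
    by (simp_all add: G_def)
  interpret G: torus_partitioned_group G centre
  proof (intro torus_partitioned_group.intro torus_partitioned_group_axioms.intro)
    show "group G" unfolding G_def by (rule SL2.subgroup_imp_group[OF B])
    show "finite (carrier G)" unfolding G using finite_SL2[OF p_pos] B.subset finite_subset by blast
    show "subgroup centre G"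
      unfolding G_def by (rule SL2.subgroup_incl[OF subgroup_centre B]) (auto simp: centre_eq diag_in_B)
    show "card centre = 2" by (rule card_centre)
    show "z \<otimes>\<^bsub>G\<^esub> g = g \<otimes>\<^bsub>G\<^esub> z" if "z \<in> centre" "g \<in> carrier G" for z g
      using centre_commute that B.mem_carrier by (simp add: G)
    show "v \<otimes>\<^bsub>G\<^esub> w = w \<otimes>\<^bsub>G\<^esub> v"
      if "u \<in> carrier G - centre" "v \<in> carrier G" "w \<in> carrier G"
        "u \<otimes>\<^bsub>G\<^esub> v = v \<otimes>\<^bsub>G\<^esub> u" "u \<otimes>\<^bsub>G\<^esub> w = w \<otimes>\<^bsub>G\<^esub> u" for u v w
      using centralizer_commutative[OF semisimple, of u v w] that by (simp add: G)
    show "v = u \<or> u \<otimes>\<^bsub>G\<^esub> v = \<one>\<^bsub>G\<^esub>"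
      if "u \<in> carrier G - centre" "g \<in> carrier G" "v \<in> carrier G"
        "g \<otimes>\<^bsub>G\<^esub> u = v \<otimes>\<^bsub>G\<^esub> g" "u \<otimes>\<^bsub>G\<^esub> v = v \<otimes>\<^bsub>G\<^esub> u" for u g v
      using conjugate_in_torus[OF semisimple, of u g v] that by (simp add: G)
  qed
  have x': "diag 1 \<in> carrier G - centre"
    using x by (simp add: G centre_eq diag_eq_iff)
  have normalizer: "g \<in> G.torus_normalizer (diag 1) \<longleftrightarrow>
      (\<exists>v\<in>B. diag 1 \<otimes>\<^bsub>SL2 p\<^esub> v = v \<otimes>\<^bsub>SL2 p\<^esub> diag 1 \<and> g \<otimes>\<^bsub>SL2 p\<^esub> diag 1 = v \<otimes>\<^bsub>SL2 p\<^esub> g)" if "g \<in> B" for g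
    using that x G.conjugate_eq_iff_commute[of g "diag 1"]
    by (auto simp: G.torus_normalizer_def G.torus_def G intro: G.conjugate_closed[unfolded G])
  have "(\<lambda>m. diag m) ` {0..<16} \<subseteq> G.torus (diag 1)"
    by (auto simp: G.torus_def G diag_in_B diag_mult_diag add.commute)
  moreover have "card (diag ` {0..<16}) = 16"
    by (subst card_image) (auto simp: inj_on_def diag_eq_iff)
  ultimately have large: "16 \<le> card (G.torus (diag 1))"
    using card_mono[OF G.finite_torus] by metis
  have "antidiag 0 \<in> G.torus_normalizer (diag 1)"
    unfolding normalizer[OF in_B(1)]
    by (intro bexI[of _ "diag (- 1)"]) (simp_all add: diag_mult_diag diag_mult_antidiag antidiag_mult_diag diag_in_B)
  moreover have "antidiag 0 \<notin> G.torus (diag 1)"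
    by (simp add: G.torus_def G diag_mult_antidiag antidiag_mult_diag antidiag_eq_iff)
  ultimately have inverted: "antidiag 0 \<in> G.torus_normalizer (diag 1) - G.torus (diag 1)" by simp
  have "full 0 0 \<notin> G.torus_normalizer (diag 1)"
  proof
    assume "full 0 0 \<in> G.torus_normalizer (diag 1)"
    then obtain v where v: "v \<in> B" "diag 1 \<otimes>\<^bsub>SL2 p\<^esub> v = v \<otimes>\<^bsub>SL2 p\<^esub> diag 1"
      "full 0 0 \<otimes>\<^bsub>SL2 p\<^esub> diag 1 = v \<otimes>\<^bsub>SL2 p\<^esub> full 0 0"
      unfolding normalizer[OF in_B(2)] by blast
    have "v = diag 1 \<or> diag 1 \<otimes>\<^bsub>SL2 p\<^esub> v = \<one>\<^bsub>SL2 p\<^esub>"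
      using G.conjugate_commuting[OF x', of "full 0 0" v] v in_B by (simp add: G)
    then have "v = diag 1 \<or> v = diag (- 1)"
    proof
      assume "diag 1 \<otimes>\<^bsub>SL2 p\<^esub> v = \<one>\<^bsub>SL2 p\<^esub>"
      then have "diag (- 1) \<otimes>\<^bsub>SL2 p\<^esub> (diag 1 \<otimes>\<^bsub>SL2 p\<^esub> v) = diag (- 1)" by (simp add: diag_in_SL2)
      then have "v = diag (- 1)"
        using B.mem_carrier[OF v(1)] by (simp flip: SL2.m_assoc add: diag_in_SL2 diag_mult_diag diag_0)
      then show ?thesis ..
    qed simp
    with v(3) show False by (auto simp: full_mult_diag diag_mult_full full_eq_iff)
  qed
  then have "full 0 0 \<in> carrier G - G.torus_normalizer (diag 1)" using in_B by (simp add: G)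
  with G.no_large_torus[OF x' large inverted] show False .
qed

lemma core_exists:
  "\<exists>S. subgroup_plus_coset_core (SL2 p) S \<and> card S = 64 \<and>
    card (S <#>\<^bsub>SL2 p\<^esub> S <#>\<^bsub>SL2 p\<^esub> S) = 224"
proof (intro exI conjI)
  let ?x = "diag 1"
  let ?S = "H \<union> ((?x <#\<^bsub>SL2 p\<^esub> H) \<inter> (H #>\<^bsub>SL2 p\<^esub> ?x))"
  have x: "?x \<in> carrier (SL2 p)" "?x \<notin> H" by (simp_all add: diag_in_SL2 diag_in_H_iff)
  have xx: "?x \<otimes>\<^bsub>SL2 p\<^esub> ?x \<in> H" by (simp add: diag_mult_diag diag_in_H_iff)
  have sub: "H \<union> {?x} \<subseteq> carrier (SL2 p)" using H_subset x by simp
  have "generate (SL2 p) (H \<union> {?x}) = carrier (SL2 p)"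
    by (rule subgroup_containing_H_and_root_is_SL2[OF SL2.generate_is_subgroup[OF sub]])
      (auto intro: generate.incl)
  moreover have "?x [^]\<^bsub>SL2 p\<^esub> (2::nat) \<in> H"
    using xx x by (simp add: numeral_2_eq_2)
  ultimately show "subgroup_plus_coset_core (SL2 p) ?S"
    unfolding subgroup_plus_coset_core_def using subgroup_H x by blast
  note counts = SL2.card_core_and_cube[OF subgroup_H finite_H x xx translate_double_coset_disjoint
      card_H_inter_translate[symmetric], unfolded card_H]
  show "card ?S = 64" using counts(1) by simp
  show "card (?S <#>\<^bsub>SL2 p\<^esub> ?S <#>\<^bsub>SL2 p\<^esub> ?S) = 224" using counts(2) by simp
qed

end

text \<open>
  The power of a primitive root with exponent \<open>(p - 1) / 16\<close> has order 16, so its eighth power is a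
  square root of one other than one.
\<close>

lemma exists_sixteenth_root_of_unity:
  assumes p: "Factorial_Ring.prime p" and "[p = 1] (mod 16)"
  shows "\<exists>z. [z ^ 8 = - 1] (mod int p)"
proof -
  have "p \<noteq> 2" "p > 1" using assms prime_gt_1_nat by (auto simp: cong_def)
  then have p2: "p > 2" by simp
  obtain g where g: "residue_primroot p g"
    using prime_primitive_root_exists[of p] p \<open>p > 1\<close> by auto
  then have ord: "ord p g = p - 1"
    using p by (simp add: residue_primroot_def totient_prime)
  have "16 dvd p - 1"
    using assms(2) p2 by (simp add: cong_altdef_nat)
  then obtain k where k: "p - 1 = 16 * k" ..
  then have "k > 0" using p2 by (cases k) auto
  define z where "z = int (g ^ k)"
  have pow: "[z ^ n = 1] (mod int p) \<longleftrightarrow> 16 * k dvd k * n" for n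
  proof -
    have "[z ^ n = 1] (mod int p) \<longleftrightarrow> [int (g ^ (k * n)) = int 1] (mod int p)"
      by (simp add: z_def power_mult)
    also have "\<dots> \<longleftrightarrow> [g ^ (k * n) = 1] (mod p)" by (rule cong_int_iff)
    also have "\<dots> \<longleftrightarrow> 16 * k dvd k * n" unfolding ord_divides ord k ..
    finally show ?thesis .
  qed
  have "int p dvd z ^ 16 - 1" using pow[of 16] by (simp add: cong_iff_dvd_diff)
  also have "z ^ 16 - 1 = (z ^ 8 - 1) * (z ^ 8 + 1)"
    by (simp add: algebra_simps flip: power_add)
  finally have "int p dvd z ^ 8 - 1 \<or> int p dvd z ^ 8 + 1"
    using p by (simp add: prime_dvd_mult_iff)
  moreover have "\<not> int p dvd z ^ 8 - 1"
    using pow[of 8] \<open>k > 0\<close> dvd_imp_le[of "16 * k" "k * 8"] by (auto simp: cong_iff_dvd_diff)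
  ultimately have "[z ^ 8 = - 1] (mod int p)" by (simp add: cong_iff_dvd_diff)
  then show ?thesis ..
qed

theorem corollary6p4:
  fixes p :: nat
  assumes "Factorial_Ring.prime p" and "[p = 1] (mod 16)"
  shows "\<exists>S. subgroup_plus_coset_core (SL2 p) S \<and> card S = 64 \<and>
           card (S <#>\<^bsub>SL2 p\<^esub> S <#>\<^bsub>SL2 p\<^esub> S) = 224"
proof -
  have "p \<noteq> 2" "p > 1" using assms prime_gt_1_nat by (auto simp: cong_def)
  then have p2: "p > 2" by simp
  obtain z where z: "[z ^ 8 = - 1] (mod int p)" using exists_sixteenth_root_of_unity[OF assms] by blast
  have "odd p" using p2 assms(1) prime_odd_nat by blast
  then have "2 dvd int p + 1" by simp
  \<comment> \<open>\<open>(p + 1) / 2\<close> is the inverse of 2 modulo \<open>p\<close>\<close>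
  then have "2 * ((int p + 1) div 2) = int p + 1" by (rule dvd_mult_div_cancel)
  then have "[2 * ((int p + 1) div 2) = 1] (mod int p)" by (simp add: cong_def)
  then have "[2 * ((int p + 1) div 2) * (z ^ 2 - z ^ 6) = 1 * (z ^ 2 - z ^ 6)] (mod int p)"
    by (rule cong_mult) simp
  then have "[2 * ((int p + 1) div 2 * (z ^ 2 - z ^ 6)) = z ^ 2 - z ^ 6] (mod int p)"
    by (simp add: mult.assoc)
  then interpret binary_octahedral p z "(int p + 1) div 2 * (z ^ 2 - z ^ 6)"
    using assms p2 z by unfold_locales
  show ?thesis by (rule core_exists)
qed

end
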